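(* Let $n\ge 1$, and let $\mathcal{S}=\bigcup_{k=0}^{\infty}\mathcal{S}_k$ be the family of cubes in $\mathbb{R}^n$ given by $\mathcal{S}_0=\{[0,2^{-N})^n: N=0,1,2,\dots\}$ and $\mathcal{S}_k=\{[2^k,2^k+2^{-N})^n: N=0,1,2,\dots\}$ for $k\ge 1$. For every $p\in(1,\infty)$ there exists a weight $w$ on $\mathbb{R}^n$ such that the Hardy-Littlewood maximal operator $M$ is bounded from $L^p(w)$ to $L^p(w)$, while the sparse operator $T_{\mathcal{S}}$ is unbounded from $L^p(w)$ to $L^p(w)$.
   Context: Sparse operator: $T_{\mathcal{S}}f(x)=\sum_{Q\in\mathcal{S}}\frac{1}{|Q|}\int_Q f(y)\,dy\;\mathbf{1}_Q(x)$ (taking values in $[0,\infty]$ for $f\ge 0$). Maximal operator: $Mf(x)=\sup_{Q\ni x}\frac{1}{|Q|}\int_Q|f(y)|\,dy$, the supremum being over all cubes $Q\subset\mathbb{R}^n$ with sides parallel to the axes containing $x$. Weights: a weight is a nonnegative locally integrable function on $\mathbb{R}^n$; weights are allowed to vanish on sets of positive measure. Here $\operatorname{supp}(w)$ denotes the set where $w>0$ (up to null sets). Weighted spaces: $\|f\|_{L^p(w)}=\left(\int_{\mathbb{R}^n}|f|^p w\,dx\right)^{1/p}$, and $L^p(w)$ consists of the measurable functions $f$ whose support is contained in $\operatorname{supp}(w)$ and for which $\|f\|_{L^p(w)}<\infty$. Boundedness: an operator $T$ is bounded from $L^p(w)$ to $L^p(w)$ if there is a finite constant $C$ with $\left(\int|Tf|^p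 w\,dx\right)^{1/p}\le C\|f\|_{L^p(w)}$ for all $f\in L^p(w)$ (here $Tf$ itself need not be supported in $\operatorname{supp}(w)$); otherwise it is unbounded. For the positive operator $T_{\mathcal{S}}$ it is equivalent to test only nonnegative $f$. *)

theory Defs
  imports "HOL-Analysis.Analysis"
begin

definition half_open_cube :: "real^'n \<Rightarrow> real \<Rightarrow> (real^'n) set" where
  "half_open_cube a l = {x. \<forall>i. a $ i \<le> x $ i \<and> x $ i < a $ i + l}"

text \<open>Cubes are taken half-open.  The maximal function below is unaffected by this
  choice: a closed or open cube containing \<open>x\<close> is approximated from outside or from inside by
  half-open cubes containing \<open>x\<close>, with convergence of the averages.\<close>
definition cubes :: "(real^'n) set set" where
  "cubes = {half_open_cube a l | a l. l > 0}"

definition cube_average :: "(real^'n) set \<Rightarrow> (real^'n \<Rightarrow> ennreal) \<Rightarrow> ennreal" where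
  "cube_average Q g = (\<integral>\<^sup>+y\<in>Q. g y \<partial>lebesgue) / emeasure lebesgue Q"

definition maximal_operator :: "(real^'n \<Rightarrow> real) \<Rightarrow> real^'n \<Rightarrow> ennreal" where
  "maximal_operator f x = (SUP Q\<in>{Q \<in> cubes. x \<in> Q}. cube_average Q (\<lambda>y. ennreal \<bar>f y\<bar>))"

text \<open>Meaningful for \<open>f \<ge> 0\<close> only, since \<^const>\<open>ennreal\<close> sends negative reals to \<open>0\<close>.  The sum
  over \<open>S\<close> always exists in \<^typ>\<open>ennreal\<close>, possibly with value \<open>\<infinity>\<close>.\<close>
definition sparse_operator ::
    "(real^'n) set set \<Rightarrow> (real^'n \<Rightarrow> real) \<Rightarrow> real^'n \<Rightarrow> ennreal" where
  "sparse_operator S f x = (\<Sum>\<^sub>\<infinity>Q\<in>S. cube_average Q (\<lambda>y. ennreal (f y)) * indicator Q x)"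

definition corner_level :: "nat \<Rightarrow> (real^'n) set set" where
  "corner_level k =
     (if k = 0 then range (\<lambda>N::nat. half_open_cube 0 (1 / 2 ^ N))
      else range (\<lambda>N::nat. half_open_cube (vec (2 ^ k)) (1 / 2 ^ N)))"

definition corner_family :: "(real^'n) set set" where
  "corner_family = (\<Union>k. corner_level k)"

text \<open>Weights may vanish on sets of positive measure.\<close>
definition weight :: "(real^'n \<Rightarrow> real) \<Rightarrow> bool" where
  "weight w \<longleftrightarrow> (\<forall>x. 0 \<le> w x) \<and> (\<forall>K. compact K \<longrightarrow> set_integrable lebesgue K w)"

text \<open>Real powers on \<open>[0,\<infinity>]\<close>, for exponents \<open>p > 0\<close>.\<close>
definition ennreal_powr :: "ennreal \<Rightarrow> real \<Rightarrow> ennreal" where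
  "ennreal_powr t p = (if t = \<infinity> then \<infinity> else ennreal (enn2real t powr p))"

definition weighted_norm :: "real \<Rightarrow> (real^'n \<Rightarrow> real) \<Rightarrow> (real^'n \<Rightarrow> ennreal) \<Rightarrow> ennreal" where
  "weighted_norm p w g =
     ennreal_powr (\<integral>\<^sup>+x. ennreal_powr (g x) p * ennreal (w x) \<partial>lebesgue) (1 / p)"

text \<open>The middle condition says that \<open>f\<close> is supported in \<open>{x. w x > 0}\<close> up to a null set.\<close>
definition weighted_Lp :: "real \<Rightarrow> (real^'n \<Rightarrow> real) \<Rightarrow> (real^'n \<Rightarrow> real) set" where
  "weighted_Lp p w =
     {f. f \<in> borel_measurable lebesgue \<and>
         (AE x in lebesgue. f x \<noteq> 0 \<longrightarrow> w x > 0) \<and>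
         weighted_norm p w (\<lambda>x. ennreal \<bar>f x\<bar>) < \<infinity>}"

text \<open>\<open>F\<close> is the class of admissible inputs: \<^const>\<open>UNIV\<close> for the maximal operator, and the
  nonnegative functions for the sparse operator, which is defined on those only.  By
  positivity of the sparse operator this does not affect its boundedness.\<close>
definition bounded_on_weighted_Lp ::
    "(real^'n \<Rightarrow> real) set \<Rightarrow> real \<Rightarrow> (real^'n \<Rightarrow> real) \<Rightarrow>
     ((real^'n \<Rightarrow> real) \<Rightarrow> real^'n \<Rightarrow> ennreal) \<Rightarrow> bool" where
  "bounded_on_weighted_Lp F p w T \<longleftrightarrow>
     (\<exists>C::real. C \<ge> 0 \<and> (\<forall>f \<in> weighted_Lp p w \<inter> F.
        weighted_norm p w (T f) \<le> ennreal C * weighted_norm p w (\<lambda>x. ennreal \<bar>f x\<bar>)))"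

end

theory Submission
  imports Defs
begin

text \<open>
  Only the cubes with a corner at the origin matter. Let \<open>Q\<^sub>j = [0, 2\<^sup>-\<^sup>j)\<^sup>n\<close>, and let the weight
  live on small blocks \<open>E\<^sub>j\<close>, one in each \<open>Q\<^sub>j\<close> and outside \<open>Q\<^bsub>j+1\<^esub>\<close>, on each of which it is
  constant with total weighted mass \<open>\<mu>\<^sub>j\<close>. The masses sum to \<open>1\<close>, and the volume of \<open>E\<^sub>j\<close> is
  \<open>\<mu>\<^sub>j\<^bsup>1/p\<^esup>\<close> times that of \<open>Q\<^sub>j\<close>, up to a factor depending on \<open>n\<close> only. This choice of volume makes
  the average \<open>G\<^sub>j\<close> of \<open>\<bar>f\<bar> 1\<^bsub>E\<^sub>j\<^esub>\<close> over \<open>Q\<^sub>j\<close> satisfy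
  \<open>G\<^sub>j\<^sup>p \<lesssim> \<integral>\<^bsub>E\<^sub>j\<^esub> \<bar>f\<bar>\<^sup>p w\<close>, with equality up to constants if \<open>\<bar>f\<bar>\<close> is constant on \<open>E\<^sub>j\<close>.
  So the norm of \<open>f\<close> controls the sequence \<open>G\<close> in \<open>\<ell>\<^sup>p\<close>, and nothing better.

  The maximal operator sees only \<open>sup G\<close>. The blocks are separated at their own scale, hence a cube that
  meets \<open>E\<^sub>j\<close> and another block has at least the size of the largest block scale it meets, up to a
  constant, and the other blocks contribute \<open>O(sup G)\<close> to its average. Since \<open>sup G\<close> is at most the \<open>\<ell>\<^sup>p\<close> norm of \<open>G\<close> and the
  total mass is \<open>1\<close>, this contribution is bounded. What remains is the
  part of \<open>f\<close> on the block \<open>E\<^sub>j\<close> itself, where the weight is constant, and there the unweighted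
  Hardy-Littlewood maximal theorem applies.

  The sparse operator sees \<open>\<Sum>\<^bsub>i\<le>j\<^esub> G\<^sub>i\<close> on \<open>E\<^sub>j\<close>. If \<open>G\<^sub>i\<close> is a constant for \<open>i < m\<close> and \<open>0\<close> from then
  on, the \<open>p\<close>-th power of the norm of \<open>f\<close> is proportional to \<open>m\<close>, whereas the \<open>p\<close>-th power of the
  norm of its image is at least a constant times \<open>m\<^sup>p \<Sum>\<^bsub>j\<ge>m\<^esub> \<mu>\<^sub>j\<close>. As \<open>p > 1\<close>, tails of the masses that decay
  like \<open>m\<^bsup>-(p-1)/2\<^esup>\<close> are slow enough for the quotient to be unbounded.

  The two halves are \<open>maximal_operator_bounded\<close> and \<open>sparse_operator_unbounded\<close>; the maximal
  theorem for the Lebesgue measure is \<open>ball_maximal_strong_type\<close>, proved from the Vitali covering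
  lemma by interpolation.
\<close>

section \<open>Real powers of extended nonnegative reals\<close>

lemma ennreal_powr_ennreal [simp]: "0 \<le> a \<Longrightarrow> ennreal_powr (ennreal a) p = ennreal (a powr p)"
  by (simp add: ennreal_powr_def)

lemma ennreal_powr_top [simp]: "ennreal_powr top p = top"
  by (simp add: ennreal_powr_def)

lemma ennreal_powr_zero [simp]: "ennreal_powr 0 p = 0"
  by (simp add: ennreal_powr_def)

lemma ennreal_powr_mono:
  assumes "0 \<le> p" "s \<le> t"
  shows "ennreal_powr s p \<le> ennreal_powr t p"
  using assms by (cases s; cases t) (auto intro!: ennreal_leI powr_mono2 simp: top_unique)

lemma ennreal_powr_measurable [measurable]: "(\<lambda>t. ennreal_powr t p) \<in> borel_measurable borel"
  unfolding ennreal_powr_def by measurable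

lemma ennreal_powr_cmult:
  assumes "0 < c" "0 < p"
  shows "ennreal_powr (ennreal c * t) p = ennreal (c powr p) * ennreal_powr t p"
  using assms by (cases t) (auto simp: ennreal_mult[symmetric] powr_mult ennreal_mult_top)

lemma ennreal_powr_inverse_powr:
  assumes "0 < p"
  shows "ennreal_powr (ennreal_powr t (1 / p)) p = t"
  using assms by (cases t) (auto simp: powr_powr)

lemma ennreal_powr_add_le:
  assumes "0 < p"
  shows "ennreal_powr (s + t) p \<le> ennreal (2 powr p) * (ennreal_powr s p + ennreal_powr t p)"
proof -
  have "ennreal_powr (s + t) p \<le> ennreal_powr (ennreal 2 * max s t) p"
    using assms by (intro ennreal_powr_mono) (auto simp: mult_2 max_def add_mono)
  also have "\<dots> = ennreal (2 powr p) * ennreal_powr (max s t) p"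
    using assms by (simp only: ennreal_powr_cmult)
  also have "\<dots> \<le> ennreal (2 powr p) * (ennreal_powr s p + ennreal_powr t p)"
    by (intro mult_left_mono) (auto simp: max_def)
  finally show ?thesis .
qed

section \<open>The Hardy-Littlewood maximal theorem for balls\<close>

text \<open>The supremum runs over all balls containing \<open>x\<close>, not only those centred at \<open>x\<close>: then the superlevel
sets are unions of balls, hence open, for an arbitrary \<open>g\<close>.\<close>

definition ball_maximal :: "('a::euclidean_space \<Rightarrow> ennreal) \<Rightarrow> 'a \<Rightarrow> ennreal" where
  "ball_maximal g x = (SUP (c, r) \<in> {(c, r). 0 < r \<and> x \<in> ball c r}.
     (\<integral>\<^sup>+y\<in>ball c r. g y \<partial>lebesgue) / emeasure lebesgue (ball c r))"

lemma less_ball_maximal_iff: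
  "t < ball_maximal g x \<longleftrightarrow> (\<exists>c r. 0 < r \<and> x \<in> ball c r \<and>
     t < (\<integral>\<^sup>+y\<in>ball c r. g y \<partial>lebesgue) / emeasure lebesgue (ball c r))"
  unfolding ball_maximal_def by (auto simp: less_SUP_iff)

lemma average_le_ball_maximal:
  assumes "0 < r" "x \<in> ball c r"
  shows "(\<integral>\<^sup>+y\<in>ball c r. g y \<partial>lebesgue) / emeasure lebesgue (ball c r) \<le> ball_maximal g x"
  unfolding ball_maximal_def using assms
  by (intro SUP_upper2[where i="(c, r)"]) auto

lemma open_ball_maximal_superlevel: "open {x. t < ball_maximal g x}"
proof -
  have "{x. t < ball_maximal g x} = (\<Union>(c, r) \<in> {(c, r). 0 < r \<and>
     t < (\<integral>\<^sup>+y\<in>ball c r. g y \<partial>lebesgue) / emeasure lebesgue (ball c r)}. ball c r)"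
    by (auto simp del: emeasure_completion simp: less_ball_maximal_iff)
       (metis dist_commute)+
  then show ?thesis by (auto intro!: open_UN)
qed

lemma ball_maximal_measurable [measurable]: "ball_maximal g \<in> borel_measurable lebesgue"
  by (rule borel_measurableI_greater)
     (auto intro!: borel_open open_ball_maximal_superlevel sets_completionI_sets)

lemma inverse_mult_ennreal: "0 < c \<Longrightarrow> inverse (ennreal c) * ennreal c = 1"
  by (simp add: inverse_ennreal ennreal_mult[symmetric])

text \<open>The balls on which the average of \<open>g\<close> exceeds \<open>t\<close> cover the superlevel set. Their radii are bounded
because \<open>g\<close> is integrable (otherwise there is nothing to prove), so Vitali's lemma selects disjoint
ones whose fivefold enlargements still cover.\<close>

lemma ball_maximal_weak_type:
  fixes g :: "'a::euclidean_space \<Rightarrow> ennreal"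
  assumes g [measurable]: "g \<in> borel_measurable lebesgue" and t: "0 < t"
  shows "ennreal t * emeasure lebesgue {x. ennreal t < ball_maximal g x}
    \<le> ennreal (5 ^ DIM('a)) * (\<integral>\<^sup>+x. g x \<partial>lebesgue)"
proof (cases "(\<integral>\<^sup>+x. g x \<partial>lebesgue) = \<infinity>")
  case True
  then show ?thesis by (simp add: ennreal_mult_top)
next
  case False
  define V where "V = unit_ball_vol (real DIM('a))"
  have V: "0 < V" unfolding V_def by simp
  define I where "I = enn2real (\<integral>\<^sup>+x. g x \<partial>lebesgue)"
  have I: "(\<integral>\<^sup>+x. g x \<partial>lebesgue) = ennreal I" "0 \<le> I"
    using False by (auto simp: I_def less_top)
  define K where "K = {(c :: 'a, r). 0 < r \<and>
     ennreal t < (\<integral>\<^sup>+y\<in>ball c r. g y \<partial>lebesgue) / emeasure lebesgue (ball c r)}"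
  let ?B = "\<lambda>i::'a \<times> real. ball (fst i) (snd i)"
  have avg: "ennreal t * emeasure lebesgue (?B i) \<le> (\<integral>\<^sup>+y\<in>?B i. g y \<partial>lebesgue)"
    if "i \<in> K" for i
  proof -
    have r: "0 < snd i" using that by (auto simp: K_def)
    have em: "emeasure lebesgue (?B i) = ennreal (V * snd i ^ DIM('a))"
      using r by (simp add: emeasure_ball V_def)
    have pos: "0 < V * snd i ^ DIM('a)" using V r by simp
    have "ennreal t * emeasure lebesgue (?B i)
        \<le> (\<integral>\<^sup>+y\<in>?B i. g y \<partial>lebesgue) / emeasure lebesgue (?B i) * emeasure lebesgue (?B i)"
      using that by (intro mult_right_mono) (auto simp: K_def)
    also have "\<dots> = (\<integral>\<^sup>+y\<in>?B i. g y \<partial>lebesgue)"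
      unfolding em using pos by (simp add: divide_ennreal_def mult.assoc inverse_mult_ennreal)
    finally show ?thesis .
  qed
  have rbound: "0 < snd i \<and> snd i \<le> max 1 (I / (t * V))" if "i \<in> K" for i
  proof -
    have r: "0 < snd i" using that by (auto simp: K_def)
    have "ennreal (t * (V * snd i ^ DIM('a))) = ennreal t * emeasure lebesgue (?B i)"
      using r t V by (simp add: emeasure_ball V_def ennreal_mult)
    also have "\<dots> \<le> (\<integral>\<^sup>+y\<in>?B i. g y \<partial>lebesgue)" by (rule avg[OF that])
    also have "\<dots> \<le> (\<integral>\<^sup>+x. g x \<partial>lebesgue)"
      by (intro nn_integral_mono) (auto split: split_indicator)
    finally have "t * (V * snd i ^ DIM('a)) \<le> I" using I by simp
    then have *: "snd i ^ DIM('a) \<le> I / (t * V)" using t V by (simp add: field_simps)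
    have "snd i \<le> snd i ^ DIM('a)" if "1 \<le> snd i"
      using power_increasing[of 1 "DIM('a)" "snd i"] that by simp
    then have "snd i \<le> max 1 (snd i ^ DIM('a))" by linarith
    also have "\<dots> \<le> max 1 (I / (t * V))" using * by (rule max.mono[OF order_refl])
    finally show ?thesis using r by simp
  qed
  have "{x. ennreal t < ball_maximal g x} \<subseteq> (\<Union>i\<in>K. cball (fst i) (snd i))"
  proof
    fix x assume "x \<in> {x. ennreal t < ball_maximal g x}"
    then obtain c r where "(c, r) \<in> K" "x \<in> ball c r"
      unfolding mem_Collect_eq less_ball_maximal_iff K_def by blast
    then show "x \<in> (\<Union>i\<in>K. cball (fst i) (snd i))" by force
  qed
  from Vitali_covering_lemma_cballs[OF this rbound] obtain C where
    C: "countable C" "C \<subseteq> K"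
       "pairwise (\<lambda>i j. disjnt (cball (fst i) (snd i)) (cball (fst j) (snd j))) C"
       "{x. ennreal t < ball_maximal g x} \<subseteq> (\<Union>i\<in>C. cball (fst i) (5 * snd i))"
    by blast
  have dis: "disjoint_family_on ?B C"
    unfolding disjoint_family_on_def
  proof (intro ballI impI)
    fix i j assume "i \<in> C" "j \<in> C" "i \<noteq> j"
    then have "disjnt (cball (fst i) (snd i)) (cball (fst j) (snd j))"
      using C(3) by (auto simp: pairwise_def)
    then show "?B i \<inter> ?B j = {}"
      unfolding disjnt_def using ball_subset_cball by blast
  qed
  have "emeasure lebesgue {x. ennreal t < ball_maximal g x}
      \<le> emeasure lebesgue (\<Union>i\<in>C. cball (fst i) (5 * snd i))"
    using C(4,1) by (intro emeasure_mono) (auto intro!: sets.countable_UN'')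
  also have "\<dots> = (\<integral>\<^sup>+x. indicator (\<Union>i\<in>C. cball (fst i) (5 * snd i)) x \<partial>lebesgue)"
    using C(1) by (subst nn_integral_indicator) (auto intro!: sets.countable_UN'')
  also have "\<dots> \<le> (\<integral>\<^sup>+x. (\<integral>\<^sup>+i. indicator (cball (fst i) (5 * snd i)) x \<partial>count_space C) \<partial>lebesgue)"
  proof (intro nn_integral_mono)
    fix x :: 'a
    show "indicator (\<Union>i\<in>C. cball (fst i) (5 * snd i)) x
      \<le> (\<integral>\<^sup>+i. (indicator (cball (fst i) (5 * snd i)) x :: ennreal) \<partial>count_space C)"
    proof (cases "\<exists>i\<in>C. x \<in> cball (fst i) (5 * snd i)")
      case True
      then obtain i where i: "i \<in> C" "x \<in> cball (fst i) (5 * snd i)" by blast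
      show ?thesis
        using nn_integral_ge_point[OF i(1), of "\<lambda>i. indicator (cball (fst i) (5 * snd i)) x"] i
        by (auto split: split_indicator simp del: mem_cball)
    next
      case False
      then show ?thesis by (auto split: split_indicator)
    qed
  qed
  also have "\<dots> = (\<integral>\<^sup>+i. (\<integral>\<^sup>+x. indicator (cball (fst i) (5 * snd i)) x \<partial>lebesgue) \<partial>count_space C)"
    using C(1) by (intro nn_integral_count_space_nn_integral borel_measurable_indicator) auto
  also have "\<dots> = (\<integral>\<^sup>+i. ennreal (5 ^ DIM('a)) * emeasure lebesgue (?B i) \<partial>count_space C)"
  proof (intro nn_integral_cong)
    fix i assume "i \<in> space (count_space C)"
    then have "i \<in> K" using C(2) by auto
    then have "0 < snd i" using rbound by blast
    then show "(\<integral>\<^sup>+x. indicator (cball (fst i) (5 * snd i)) x \<partial>lebesgue)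
       = ennreal (5 ^ DIM('a)) * emeasure lebesgue (?B i)"
      using V by (simp add: emeasure_ball emeasure_cball power_mult_distrib V_def
          ennreal_mult[symmetric] mult_ac)
  qed
  finally have "ennreal t * emeasure lebesgue {x. ennreal t < ball_maximal g x}
     \<le> ennreal t * (\<integral>\<^sup>+i. ennreal (5 ^ DIM('a)) * emeasure lebesgue (?B i) \<partial>count_space C)"
    by (intro mult_left_mono) auto
  also have "\<dots> = ennreal (5 ^ DIM('a)) * (\<integral>\<^sup>+i. ennreal t * emeasure lebesgue (?B i) \<partial>count_space C)"
    by (simp add: nn_integral_cmult mult.left_commute)
  also have "\<dots> \<le> ennreal (5 ^ DIM('a)) * (\<integral>\<^sup>+i. emeasure (density lebesgue g) (?B i) \<partial>count_space C)"
  proof (intro mult_left_mono nn_integral_mono)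
    fix i assume "i \<in> space (count_space C)"
    then have "i \<in> K" using C(2) by auto
    then show "ennreal t * emeasure lebesgue (?B i) \<le> emeasure (density lebesgue g) (?B i)"
      using avg[of i] by (subst emeasure_density) auto
  qed simp
  also have "(\<integral>\<^sup>+i. emeasure (density lebesgue g) (?B i) \<partial>count_space C)
       = emeasure (density lebesgue g) (\<Union>i\<in>C. ?B i)"
    using C(1) dis by (intro emeasure_UN_countable[symmetric]) auto
  also have "\<dots> \<le> (\<integral>\<^sup>+x. g x \<partial>lebesgue)"
    using C(1) by (subst emeasure_density)
      (auto intro!: sets.countable_UN'' nn_integral_mono split: split_indicator)
  finally show ?thesis by (simp add: mult_left_mono)
qed

text \<open>The summand with \<open>2\<^sup>k < t \<le> 2\<^bsup>k+1\<^esup>\<close> alone suffices if \<open>t\<close> is finite and positive; if \<open>t = \<infinity>\<close>, the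
summands are unbounded. The sum over the integers is written as an integral for the counting measure,
so that it can be exchanged with the integral over space. A discrete sum of levels replaces the usual
layer-cake integral in the interpolation argument.\<close>

lemma ennreal_powr_le_dyadic_sum:
  assumes p: "0 < p"
  shows "ennreal_powr t p
    \<le> (\<integral>\<^sup>+k. ennreal (2 powr ((real_of_int k + 1) * p)) * indicator {k. ennreal (2 powr real_of_int k) < t} k
         \<partial>count_space UNIV)" (is "_ \<le> ?S")
proof -
  have single: "ennreal (2 powr ((real_of_int k + 1) * p)) \<le> ?S" if "ennreal (2 powr real_of_int k) < t" for k
    using nn_integral_ge_point[of k UNIV "\<lambda>k. ennreal (2 powr ((real_of_int k + 1) * p)) *
      indicator {k. ennreal (2 powr real_of_int k) < t} k"] that by simp
  show ?thesis
  proof (cases t)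
    case (real a)
    show ?thesis
    proof (cases "a = 0")
      case False
      then have a: "0 < a" using real by simp
      define k where "k = \<lceil>log 2 a\<rceil> - 1"
      have k: "real_of_int k < log 2 a" "log 2 a \<le> real_of_int k + 1"
        unfolding k_def by linarith+
      have "2 powr real_of_int k < a" "a \<le> 2 powr (real_of_int k + 1)"
        using k a by (simp_all add: less_log_iff log_le_iff)
      moreover from this(2) have "a powr p \<le> (2 powr (real_of_int k + 1)) powr p"
        using a p by (intro powr_mono2) auto
      ultimately show ?thesis
        using single[of k] real p by (auto simp: powr_powr ennreal_less_iff intro: order_trans[OF ennreal_leI])
    qed (use real in simp)
  next
    case top
    have *: "ennreal r \<le> ?S" for r
    proof -
      \<comment> \<open>All levels lie below \<open>t = \<infinity>\<close>, so any summand may be used; this one is at least \<open>r\<close>.\<close>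
      define k where "k = \<lceil>log 2 (max 1 r) / p\<rceil>"
      have "log 2 (max 1 r) / p \<le> real_of_int k + 1" unfolding k_def by linarith
      then have "log 2 (max 1 r) \<le> (real_of_int k + 1) * p" using p by (simp add: field_simps)
      then have "r \<le> 2 powr ((real_of_int k + 1) * p)" by (simp add: log_le_iff)
      then show ?thesis using single[of k] top by (auto intro: order_trans[OF ennreal_leI])
    qed
    have "?S = top"
    proof (cases "?S")
      case (real s)
      with *[of "s + 1"] show ?thesis by simp
    qed simp
    then show ?thesis by (metis top_greatest)
  qed
qed

text \<open>A geometric series with ratio \<open>2\<^bsup>-q\<^esup>\<close>, counted downwards from the last \<open>k\<close> with \<open>2\<^sup>k < b\<close>.\<close>

lemma dyadic_sum_le:
  assumes q: "0 < q" and b: "0 < b"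
  shows "(\<integral>\<^sup>+k. ennreal (2 powr (real_of_int k * q)) * indicator {k. 2 powr real_of_int k < b} k
         \<partial>count_space UNIV) \<le> ennreal (b powr q / (1 - 2 powr - q))"
proof -
  define K where "K = \<lceil>log 2 b\<rceil> - 1"
  have K: "2 powr real_of_int k < b \<longleftrightarrow> k \<le> K" for k
  proof -
    have "2 powr real_of_int k < b \<longleftrightarrow> real_of_int k < log 2 b"
      using b by (simp add: less_log_iff)
    also have "\<dots> \<longleftrightarrow> k \<le> K" unfolding K_def by linarith
    finally show ?thesis .
  qed
  have bij: "bij_betw (\<lambda>m. K - int m) UNIV {..K}"
    by (rule bij_betwI[where g="\<lambda>k. nat (K - k)"]) auto
  have small: "2 powr - q < 1" using q by (simp add: powr_less_one)
  have "{k. 2 powr real_of_int k < b} = {..K}" using K by auto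
  then have "(\<integral>\<^sup>+k. ennreal (2 powr (real_of_int k * q)) * indicator {k. 2 powr real_of_int k < b} k
         \<partial>count_space UNIV) = (\<integral>\<^sup>+k. ennreal (2 powr (real_of_int k * q)) \<partial>count_space {..K})"
    by (simp add: nn_integral_count_space_indicator)
  also have "\<dots> = (\<integral>\<^sup>+m. ennreal (2 powr (real_of_int (K - int m) * q)) \<partial>count_space UNIV)"
    by (rule nn_integral_bij_count_space[OF bij, symmetric])
  also have "\<dots> = (\<Sum>m. ennreal (2 powr (real_of_int K * q) * (2 powr - q) ^ m))"
    unfolding nn_integral_count_space_nat
    by (simp add: powr_realpow[symmetric] powr_powr powr_add[symmetric] algebra_simps)
  also have "\<dots> = ennreal (2 powr (real_of_int K * q) * (1 / (1 - 2 powr - q)))"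
    using small by (intro suminf_ennreal_eq sums_mult geometric_sums) auto
  also have "\<dots> \<le> ennreal (b powr q / (1 - 2 powr - q))"
  proof -
    have "2 powr (real_of_int K * q) = (2 powr real_of_int K) powr q" by (simp add: powr_powr)
    also have "\<dots> \<le> b powr q" using K[of K] q by (intro powr_mono2) auto
    finally show ?thesis using small by (intro ennreal_leI) (simp add: divide_right_mono)
  qed
  finally show ?thesis .
qed

lemma superlevel_set_lebesgue:
  assumes [measurable]: "(g :: 'a::euclidean_space \<Rightarrow> ennreal) \<in> borel_measurable lebesgue"
  shows "{y. t < g y} \<in> sets lebesgue"
proof -
  have "{y \<in> space lebesgue. t < g y} \<in> sets lebesgue" by measurable
  then show ?thesis by simp
qed

text \<open>The part of \<open>g\<close> below the height \<open>s\<close> has averages at most \<open>s\<close>.\<close>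

lemma ball_maximal_truncation:
  fixes g :: "'a::euclidean_space \<Rightarrow> ennreal"
  assumes g [measurable]: "g \<in> borel_measurable lebesgue"
  shows "ball_maximal g x \<le> ball_maximal (\<lambda>y. g y * indicator {y. ennreal s < g y} y) x + ennreal s"
  unfolding ball_maximal_def[of g]
proof (intro SUP_least, clarify)
  fix c :: 'a and r :: real
  note superlevel_set_lebesgue[OF g, measurable]
  have [measurable]: "ball c r \<in> sets lebesgue" by simp
  let ?h = "\<lambda>y. g y * indicator {y. ennreal s < g y} y"
  assume r: "0 < r" "x \<in> ball c r"
  define v where "v = unit_ball_vol (DIM('a)) * r ^ DIM('a)"
  have em: "emeasure lebesgue (ball c r) = ennreal v"
    using r by (simp add: emeasure_ball v_def)
  have pos: "0 < v" using r by (simp add: v_def)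
  have "(\<integral>\<^sup>+y\<in>ball c r. g y \<partial>lebesgue)
      \<le> (\<integral>\<^sup>+y. ?h y * indicator (ball c r) y + ennreal s * indicator (ball c r) y \<partial>lebesgue)"
    by (intro nn_integral_mono) (auto split: split_indicator)
  also have "\<dots> = (\<integral>\<^sup>+y\<in>ball c r. ?h y \<partial>lebesgue) + ennreal s * emeasure lebesgue (ball c r)"
    by (subst nn_integral_add) (measurable, simp add: nn_integral_cmult_indicator)
  finally have "(\<integral>\<^sup>+y\<in>ball c r. g y \<partial>lebesgue) / emeasure lebesgue (ball c r)
     \<le> ((\<integral>\<^sup>+y\<in>ball c r. ?h y \<partial>lebesgue) + ennreal s * emeasure lebesgue (ball c r))
        / emeasure lebesgue (ball c r)"
    by (rule divide_right_mono_ennreal)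
  also have "\<dots> = (\<integral>\<^sup>+y\<in>ball c r. ?h y \<partial>lebesgue) / emeasure lebesgue (ball c r) + ennreal s"
    unfolding em add_divide_distrib_ennreal using pos
    by (simp add: mult_divide_eq_ennreal)
  also have "\<dots> \<le> ball_maximal ?h x + ennreal s"
    using r by (intro add_right_mono average_le_ball_maximal)
  finally show "(\<integral>\<^sup>+y\<in>ball c r. g y \<partial>lebesgue) / emeasure lebesgue (ball c r) \<le> \<dots>" .
qed

text \<open>The weak type bound at height \<open>t / 2\<close> for the part of \<open>g\<close> above \<open>t / 2\<close>. Restricting the integral to
the set where \<open>g\<close> is large is what makes the sum over all dyadic heights converge.\<close>

lemma ball_maximal_superlevel_le:
  fixes g :: "'a::euclidean_space \<Rightarrow> ennreal"
  assumes g [measurable]: "g \<in> borel_measurable lebesgue" and t: "0 < t"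
  shows "ennreal t * emeasure lebesgue {x. ennreal t < ball_maximal g x}
    \<le> ennreal (2 * 5 ^ DIM('a)) * (\<integral>\<^sup>+x. g x * indicator {x. ennreal (t / 2) < g x} x \<partial>lebesgue)"
proof -
  let ?h = "\<lambda>y. g y * indicator {y. ennreal (t / 2) < g y} y"
  note superlevel_set_lebesgue[OF g, measurable]
  have "{x. ennreal t < ball_maximal g x} \<subseteq> {x. ennreal (t / 2) < ball_maximal ?h x}"
  proof safe
    fix x assume "ennreal t < ball_maximal g x"
    also have "\<dots> \<le> ball_maximal ?h x + ennreal (t / 2)" by (rule ball_maximal_truncation[OF g])
    finally have *: "ennreal (t / 2) + ennreal (t / 2) < ball_maximal ?h x + ennreal (t / 2)"
      using t by (simp flip: ennreal_plus)
    show "ennreal (t / 2) < ball_maximal ?h x"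
      by (rule ccontr) (use * add_right_mono[of "ball_maximal ?h x" "ennreal (t / 2)" "ennreal (t/2)"] in auto)
  qed
  then have "ennreal t * emeasure lebesgue {x. ennreal t < ball_maximal g x}
     \<le> ennreal t * emeasure lebesgue {x. ennreal (t / 2) < ball_maximal ?h x}"
    by (intro mult_left_mono emeasure_mono)
       (auto intro!: borel_open open_ball_maximal_superlevel sets_completionI_sets)
  also have "\<dots> = 2 * (ennreal (t / 2) * emeasure lebesgue {x. ennreal (t / 2) < ball_maximal ?h x})"
  proof -
    have "ennreal t = ennreal 2 * ennreal (t / 2)" using t by (subst ennreal_mult[symmetric]) auto
    then show ?thesis by (simp add: mult.assoc)
  qed
  also have "\<dots> \<le> 2 * (ennreal (5 ^ DIM('a)) * (\<integral>\<^sup>+x. ?h x \<partial>lebesgue))"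
    using t by (intro mult_left_mono ball_maximal_weak_type) auto
  finally show ?thesis by (simp add: ennreal_mult mult.assoc)
qed

lemma ennreal_regroup_le:
  assumes "ennreal t * e \<le> ennreal d * i" "0 \<le> a" "0 \<le> b" "0 \<le> t" "0 \<le> d"
  shows "ennreal (a * b * t) * e \<le> ennreal (a * d) * (ennreal b * i)"
proof -
  have "ennreal (a * b * t) * e = ennreal (a * b) * (ennreal t * e)"
    using assms by (simp add: ennreal_mult mult.assoc)
  also have "\<dots> \<le> ennreal (a * b) * (ennreal d * i)"
    using assms(1) by (rule mult_left_mono) simp
  also have "\<dots> = ennreal (a * d) * (ennreal b * i)"
    using assms by (simp add: ennreal_mult mult_ac)
  finally show ?thesis .
qed

lemma nn_integral_cmult_regroup:
  fixes g :: "'a \<Rightarrow> ennreal"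
  assumes [measurable]: "g \<in> borel_measurable M" "U \<in> sets M"
  shows "a * (b * (\<integral>\<^sup>+x. g x * indicator U x \<partial>M)) = (\<integral>\<^sup>+x. a * (g x * (b * indicator U x)) \<partial>M)"
  by (simp add: nn_integral_cmult[symmetric] mult.left_commute)

text \<open>Marcinkiewicz interpolation between the weak type bound and the trivial bound for bounded functions:
summing the truncated weak type bound over the heights \<open>2\<^sup>k\<close> with the factors \<open>2\<^bsup>(k+1)p\<^esup>\<close> and exchanging
sum and integral leaves, at each point, \<open>g\<close> times a geometric series of size \<open>g\<^bsup>p-1\<^esup>\<close>.\<close>

lemma ball_maximal_strong_type:
  fixes p :: real
  assumes p: "1 < p"
  obtains C where "0 < C" "\<And>g :: 'a::euclidean_space \<Rightarrow> ennreal. g \<in> borel_measurable lebesgue \<Longrightarrow>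
      (\<integral>\<^sup>+x. ennreal_powr (ball_maximal g x) p \<partial>lebesgue)
        \<le> ennreal C * (\<integral>\<^sup>+x. ennreal_powr (g x) p \<partial>lebesgue)"
proof -
  define q where "q = p - 1"
  have q: "0 < q" using p by (simp add: q_def)
  \<comment> \<open>\<open>A\<close> collects \<open>2\<^bsup>(k+1)p\<^esup> / 2\<^sup>k = 2\<^sup>p 2\<^bsup>kq\<^esup>\<close> for \<open>k = 0\<close> and the weak type constant;
    \<open>B\<close> is the bound of \<open>dyadic_sum_le\<close> for \<open>b = 2 a\<close>, divided by \<open>a\<^sup>q\<close>.\<close>
  define A where "A = 2 powr p * (2 * 5 ^ DIM('a))"
  have A: "0 < A" by (simp add: A_def)
  define B where "B = 2 powr q / (1 - 2 powr - q)"
  have "2 powr - q < 1" using q by (simp add: powr_less_one)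
  then have B: "0 < B" by (simp add: B_def)
  show ?thesis
  proof (rule that[of "A * B"])
    show "0 < A * B" using A B by simp
    fix g :: "'a \<Rightarrow> ennreal" assume g [measurable]: "g \<in> borel_measurable lebesgue"
    let ?L = "\<lambda>k::int. {x. ennreal (2 powr real_of_int k) < ball_maximal g x}"
    let ?U = "\<lambda>k::int. {x. ennreal (2 powr real_of_int k / 2) < g x}"
    have L: "?L k \<in> sets lebesgue" for k by (rule superlevel_set_lebesgue) (rule ball_maximal_measurable)
    have U: "?U k \<in> sets lebesgue" for k by (rule superlevel_set_lebesgue[OF g])
    have "(\<integral>\<^sup>+x. ennreal_powr (ball_maximal g x) p \<partial>lebesgue)
      \<le> (\<integral>\<^sup>+x. (\<integral>\<^sup>+k. ennreal (2 powr ((real_of_int k + 1) * p)) * indicator (?L k) x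
            \<partial>count_space UNIV) \<partial>lebesgue)"
      using p by (intro nn_integral_mono order_trans[OF ennreal_powr_le_dyadic_sum[of p]])
        (auto intro!: nn_integral_mono split: split_indicator)
    also have "\<dots> = (\<integral>\<^sup>+k. (\<integral>\<^sup>+x. ennreal (2 powr ((real_of_int k + 1) * p)) * indicator (?L k) x
            \<partial>lebesgue) \<partial>count_space UNIV)"
      by (intro nn_integral_count_space_nn_integral borel_measurable_times_ennreal borel_measurable_const
          borel_measurable_indicator L) simp
    also have "\<dots> \<le> (\<integral>\<^sup>+k. (\<integral>\<^sup>+x. ennreal A * (g x * (ennreal (2 powr (real_of_int k * q)) * indicator (?U k) x))
            \<partial>lebesgue) \<partial>count_space UNIV)"
    proof (rule nn_integral_mono)
      fix k :: int
      let ?t = "2 powr real_of_int k"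
      have "(real_of_int k + 1) * p = p + real_of_int k * q + real_of_int k"
        by (simp add: q_def algebra_simps)
      then have split: "2 powr ((real_of_int k + 1) * p) = 2 powr p * 2 powr (real_of_int k * q) * ?t"
        by (simp only: powr_add)
      have "(\<integral>\<^sup>+x. ennreal (2 powr ((real_of_int k + 1) * p)) * indicator (?L k) x \<partial>lebesgue)
         = ennreal (2 powr p * 2 powr (real_of_int k * q) * ?t) * emeasure lebesgue (?L k)"
        unfolding split by (rule nn_integral_cmult_indicator[OF L])
      also have "\<dots> \<le> ennreal (2 powr p * (2 * 5 ^ DIM('a))) *
          (ennreal (2 powr (real_of_int k * q)) * (\<integral>\<^sup>+x. g x * indicator (?U k) x \<partial>lebesgue))"
        by (rule ennreal_regroup_le[OF ball_maximal_superlevel_le[OF g]]) simp_all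
      also have "\<dots> = (\<integral>\<^sup>+x. ennreal A * (g x * (ennreal (2 powr (real_of_int k * q)) * indicator (?U k) x)) \<partial>lebesgue)"
        unfolding A_def[symmetric] by (rule nn_integral_cmult_regroup[OF g U])
      finally show "(\<integral>\<^sup>+x. ennreal (2 powr ((real_of_int k + 1) * p)) * indicator (?L k) x \<partial>lebesgue)
        \<le> (\<integral>\<^sup>+x. ennreal A * (g x * (ennreal (2 powr (real_of_int k * q)) * indicator (?U k) x)) \<partial>lebesgue)" .
    qed
    also have "\<dots> = (\<integral>\<^sup>+x. (\<integral>\<^sup>+k. ennreal A * (g x * (ennreal (2 powr (real_of_int k * q)) * indicator (?U k) x))
            \<partial>count_space UNIV) \<partial>lebesgue)"
      by (intro nn_integral_count_space_nn_integral[symmetric] borel_measurable_times_ennreal borel_measurable_const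
          borel_measurable_indicator U g) simp
    also have "\<dots> \<le> (\<integral>\<^sup>+x. ennreal (A * B) * ennreal_powr (g x) p \<partial>lebesgue)"
    proof (intro nn_integral_mono)
      fix x
      have "g x * (\<integral>\<^sup>+k. ennreal (2 powr (real_of_int k * q)) * indicator (?U k) x \<partial>count_space UNIV)
          \<le> ennreal B * ennreal_powr (g x) p"
      proof (cases "g x")
        case (real a)
        show ?thesis
        proof (cases "a = 0")
          case False
          then have a: "0 < a" using real by simp
          have "(\<integral>\<^sup>+k. ennreal (2 powr (real_of_int k * q)) * indicator (?U k) x \<partial>count_space UNIV)
            = (\<integral>\<^sup>+k. ennreal (2 powr (real_of_int k * q)) * indicator {k. 2 powr real_of_int k < 2 * a} k \<partial>count_space UNIV)"
            using real by (intro nn_integral_cong) (auto split: split_indicator simp: ennreal_less_iff)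
          also have "\<dots> \<le> ennreal ((2 * a) powr q / (1 - 2 powr - q))"
            using a q by (intro dyadic_sum_le) auto
          also have "(2 * a) powr q / (1 - 2 powr - q) = B * a powr q"
            using a by (simp add: B_def powr_mult)
          finally have "g x * (\<integral>\<^sup>+k. ennreal (2 powr (real_of_int k * q)) * indicator (?U k) x \<partial>count_space UNIV)
            \<le> ennreal a * ennreal (B * a powr q)"
            using real by (intro mult_mono) auto
          also have "\<dots> = ennreal (B * (a powr 1 * a powr q))"
            using a B by (simp add: ennreal_mult[symmetric] mult_ac)
          also have "a powr 1 * a powr q = a powr p"
            by (simp only: powr_add[symmetric] q_def) simp
          also have "ennreal (B * a powr p) = ennreal B * ennreal_powr (g x) p"
            using real B by (simp add: ennreal_mult)
          finally show ?thesis .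
        qed (use real in simp)
      next
        case top
        then show ?thesis using B by (simp add: ennreal_mult_top)
      qed
      then have "ennreal A * (g x * (\<integral>\<^sup>+k. ennreal (2 powr (real_of_int k * q)) * indicator (?U k) x \<partial>count_space UNIV))
          \<le> ennreal A * (ennreal B * ennreal_powr (g x) p)"
        by (rule mult_left_mono) auto
      then show "(\<integral>\<^sup>+k. ennreal A * (g x * (ennreal (2 powr (real_of_int k * q)) * indicator (?U k) x))
            \<partial>count_space UNIV) \<le> ennreal (A * B) * ennreal_powr (g x) p"
        using A B by (simp add: nn_integral_cmult ennreal_mult[of A B] mult.assoc)
    qed
    also have "\<dots> = ennreal (A * B) * (\<integral>\<^sup>+x. ennreal_powr (g x) p \<partial>lebesgue)"
      by (rule nn_integral_cmult) measurable
    finally show "(\<integral>\<^sup>+x. ennreal_powr (ball_maximal g x) p \<partial>lebesgue)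
        \<le> ennreal (A * B) * (\<integral>\<^sup>+x. ennreal_powr (g x) p \<partial>lebesgue)" .
  qed
qed

section \<open>Volumes of cubes and averages over them\<close>

lemma half_open_cube_sets [measurable]: "half_open_cube a l \<in> sets lebesgue"
proof -
  have "half_open_cube a l = (\<Inter>i. {x. a $ i \<le> x $ i} \<inter> {x. x $ i < a $ i + l})"
    by (auto simp: half_open_cube_def)
  also have "\<dots> \<in> sets borel"
    by (intro sets.countable_INT'' sets.Int borel_closed borel_open closed_halfspace_component_ge_cart
        open_halfspace_component_lt_cart) auto
  finally have "half_open_cube a l \<in> sets lborel" by simp
  then show ?thesis by (rule sets_completionI_sets)
qed

lemma emeasure_half_open_cube:
  fixes a :: "real^'n"
  assumes "0 < l"
  shows "emeasure lebesgue (half_open_cube a l) = ennreal (l ^ CARD('n))"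
proof (rule antisym)
  have *: "(a + vec l - a) \<bullet> b = l" if "b \<in> Basis" for b :: "real^'n"
    using that by (auto simp: Basis_vec_def inner_axis)
  have le: "a \<bullet> b \<le> (a + vec l) \<bullet> b" if "b \<in> Basis" for b :: "real^'n"
    using *[OF that] assms by (simp add: inner_add_left)
  have prod: "(\<Prod>b\<in>(Basis :: (real^'n) set). (a + vec l - a) \<bullet> b) = l ^ CARD('n)"
    by (subst prod.cong[OF refl *]) auto
  have "emeasure lebesgue (half_open_cube a l) \<le> emeasure lebesgue (cbox a (a + vec l))"
    by (intro emeasure_mono) (auto simp: half_open_cube_def mem_box_cart less_imp_le)
  also have "\<dots> = ennreal (l ^ CARD('n))"
    using emeasure_lborel_cbox[OF le] prod by simp
  finally show "emeasure lebesgue (half_open_cube a l) \<le> ennreal (l ^ CARD('n))" .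
  have "ennreal (l ^ CARD('n)) = emeasure lebesgue (box a (a + vec l))"
    using emeasure_lborel_box[OF le] prod by simp
  also have "\<dots> \<le> emeasure lebesgue (half_open_cube a l)"
    by (intro emeasure_mono half_open_cube_sets) (auto simp: half_open_cube_def mem_box_cart less_imp_le)
  finally show "ennreal (l ^ CARD('n)) \<le> emeasure lebesgue (half_open_cube a l)" .
qed

lemma half_open_cube_dist_component:
  assumes "x \<in> half_open_cube a l" "y \<in> half_open_cube a l"
  shows "\<bar>x $ i - y $ i\<bar> < l"
proof -
  have "a $ i \<le> x $ i" "x $ i < a $ i + l" "a $ i \<le> y $ i" "y $ i < a $ i + l"
    using assms by (auto simp: half_open_cube_def)
  then show ?thesis by linarith
qed

lemma half_open_cube_subset_ball:
  fixes a x :: "real^'n"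
  assumes l: "0 < l" and x: "x \<in> half_open_cube a l"
  shows "half_open_cube a l \<subseteq> ball x (2 * real CARD('n) * l)"
proof
  fix y assume y: "y \<in> half_open_cube a l"
  have "dist x y \<le> (\<Sum>i\<in>UNIV. \<bar>(x - y) $ i\<bar>)"
    unfolding dist_norm by (rule norm_le_l1_cart)
  also have "\<dots> \<le> (\<Sum>i\<in>(UNIV :: 'n set). l)"
    using half_open_cube_dist_component[OF x y] by (intro sum_mono) (simp add: less_imp_le)
  also have "\<dots> < 2 * real CARD('n) * l"
    using l by simp
  finally show "y \<in> ball x (2 * real CARD('n) * l)" by simp
qed

text \<open>The volume of a ball of radius \<open>2 n l\<close> divided by that of a cube of side \<open>l\<close>. The ball is the one that
\<open>half_open_cube_subset_ball\<close> puts around the cube.\<close>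

definition cube_ball_ratio :: "'n::finite itself \<Rightarrow> real" where
  "cube_ball_ratio _ = unit_ball_vol (CARD('n)) * (2 * real CARD('n)) ^ CARD('n)"

lemma cube_ball_ratio_pos: "0 < cube_ball_ratio TYPE('n::finite)"
  by (simp add: cube_ball_ratio_def)

lemma divide_ennreal_le_cmult:
  assumes "i \<le> j" "0 < u" "0 < k"
  shows "i / ennreal u \<le> ennreal k * (j / ennreal (k * u))"
proof -
  have "ennreal k * inverse (ennreal (k * u)) = inverse (ennreal u)"
    using assms by (subst (1 2) inverse_ennreal) (simp_all add: ennreal_mult[symmetric])
  then have "ennreal k * (j / ennreal (k * u)) = j / ennreal u"
    by (simp only: divide_ennreal_def mult.left_commute)
  then show ?thesis using assms(1) by (simp add: divide_right_mono_ennreal)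
qed

lemma cube_average_le_ball_maximal:
  fixes a x :: "real^'n"
  assumes l: "0 < l" and x: "x \<in> half_open_cube a l"
  shows "cube_average (half_open_cube a l) g \<le> ennreal (cube_ball_ratio TYPE('n)) * ball_maximal g x"
proof -
  define R where "R = 2 * real CARD('n) * l"
  have R: "0 < R" using l by (simp add: R_def)
  have em: "emeasure lebesgue (ball x R) = ennreal (cube_ball_ratio TYPE('n) * l ^ CARD('n))"
    using R by (simp add: emeasure_ball cube_ball_ratio_def R_def power_mult_distrib mult.assoc)
  have "(\<integral>\<^sup>+y\<in>half_open_cube a l. g y \<partial>lebesgue) \<le> (\<integral>\<^sup>+y\<in>ball x R. g y \<partial>lebesgue)"
    using half_open_cube_subset_ball[OF l x]
    by (intro nn_integral_mono) (auto simp: R_def split: split_indicator)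
  then have "cube_average (half_open_cube a l) g
      \<le> ennreal (cube_ball_ratio TYPE('n)) * ((\<integral>\<^sup>+y\<in>ball x R. g y \<partial>lebesgue) / emeasure lebesgue (ball x R))"
    unfolding cube_average_def emeasure_half_open_cube[OF l] em
    using l cube_ball_ratio_pos by (intro divide_ennreal_le_cmult) auto
  also have "\<dots> \<le> ennreal (cube_ball_ratio TYPE('n)) * ball_maximal g x"
    using R by (intro mult_left_mono average_le_ball_maximal) auto
  finally show ?thesis .
qed

section \<open>The weight carried by separated blocks\<close>
text \<open>Prescribing the tails instead of the masses turns every sum of masses into a telescoping one. Any
exponent strictly between \<open>-(p - 1)\<close> and \<open>0\<close> would do: the tails have to tend to \<open>0\<close>, but more slowly than
\<open>m\<^bsup>-(p-1)\<^esup>\<close>.\<close>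

definition tail_mass :: "real \<Rightarrow> nat \<Rightarrow> real" where
  "tail_mass p m = (real m + 1) powr (- (p - 1) / 2)"

definition mass :: "real \<Rightarrow> nat \<Rightarrow> real" where
  "mass p j = tail_mass p j - tail_mass p (Suc j)"

lemma mass_pos: "1 < p \<Longrightarrow> 0 < mass p j"
  unfolding mass_def tail_mass_def by (simp add: powr_less_mono2_neg)

lemma tail_mass_nonneg: "0 \<le> tail_mass p m"
  by (simp add: tail_mass_def)

lemma mass_le_1: assumes "1 < p" shows "mass p j \<le> 1"
proof -
  have "tail_mass p j \<le> 1"
    unfolding tail_mass_def using assms powr_mono2'[of "- (p - 1) / 2" 1 "real j + 1"] by simp
  then show ?thesis using tail_mass_nonneg[of p "Suc j"] by (simp add: mass_def)
qed

lemma mass_sums_tail: assumes "1 < p" shows "(\<lambda>j. mass p (j + m)) sums tail_mass p m"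
proof -
  have "filterlim (\<lambda>j. real j + 1) at_top sequentially"
    using filterlim_real_sequentially by (rule filterlim_at_top_mono) auto
  then have "(\<lambda>j. tail_mass p j) \<longlonglongrightarrow> 0"
    unfolding tail_mass_def using assms by (intro tendsto_neg_powr) auto
  then have "(\<lambda>j. tail_mass p (j + m)) \<longlonglongrightarrow> 0"
    by (rule LIMSEQ_ignore_initial_segment)
  from telescope_sums'[OF this] show ?thesis by (simp add: mass_def)
qed

text \<open>The block starts at the centre of \<open>[0, 2\<^sup>-\<^sup>j)\<^sup>n\<close> and its side is at most \<open>2\<^bsup>-j-2\<^esup>\<close>, which leaves room
between consecutive blocks. The power of the mass in the side gives it the volume
\<open>\<mu>\<^sub>j\<^bsup>1/p\<^esup> (4 \<sqdot> 2\<^sup>j)\<^bsup>-n\<^esup>\<close>, where \<open>\<mu>\<^sub>j\<close> is the mass.\<close>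

definition block :: "real \<Rightarrow> nat \<Rightarrow> (real^'n) set" where
  "block p j = half_open_cube (vec (1 / (2 * 2 ^ j))) (mass p j powr (1 / (p * CARD('n))) / (4 * 2 ^ j))"

definition block_volume :: "'n::finite itself \<Rightarrow> real \<Rightarrow> nat \<Rightarrow> real" where
  "block_volume _ p j = mass p j powr (1 / p) / (4 * 2 ^ j) ^ CARD('n)"

lemma block_sets [measurable]: "block p j \<in> sets lebesgue"
  unfolding block_def by (rule half_open_cube_sets)

lemma block_volume_pos: "1 < p \<Longrightarrow> 0 < block_volume TYPE('n::finite) p j"
  using mass_pos[of p j] by (simp add: block_volume_def)

lemma emeasure_block:
  assumes "1 < p"
  shows "emeasure lebesgue (block p j :: (real^'n) set) = ennreal (block_volume TYPE('n) p j)"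
proof -
  have m: "0 < mass p j" using assms by (rule mass_pos)
  have "(mass p j powr (1 / (p * CARD('n)))) ^ CARD('n) = mass p j powr (1 / p)"
    using m assms by (simp add: powr_realpow[symmetric] powr_powr)
  then show ?thesis
    unfolding block_def using m
    by (subst emeasure_half_open_cube) (auto simp: block_volume_def power_divide)
qed

lemma block_bounds:
  fixes x :: "real^'n"
  assumes p: "1 < p" and x: "x \<in> block p j"
  shows "1 / (2 * 2 ^ j) \<le> x $ i" "x $ i < 3 / (4 * 2 ^ j)"
proof -
  have "mass p j powr (1 / (p * CARD('n))) \<le> 1"
    using mass_le_1[OF p] mass_pos[OF p, of j] p by (intro powr_le1) auto
  then have "mass p j powr (1 / (p * CARD('n))) / (4 * 2 ^ j) \<le> 1 / (4 * 2 ^ j)"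
    by (simp add: divide_right_mono)
  moreover have "1 / (2 * 2 ^ j) + 1 / (4 * 2 ^ j) = 3 / (4 * 2 ^ j :: real)"
    by (simp add: field_simps)
  moreover have "1 / (2 * 2 ^ j) \<le> x $ i"
    "x $ i < 1 / (2 * 2 ^ j) + mass p j powr (1 / (p * CARD('n))) / (4 * 2 ^ j)"
    using x by (simp_all add: block_def half_open_cube_def)
  ultimately show "1 / (2 * 2 ^ j) \<le> x $ i" "x $ i < 3 / (4 * 2 ^ j)" by linarith+
qed

lemma block_subset_corner_cube:
  assumes "1 < p" "N \<le> j"
  shows "block p j \<subseteq> half_open_cube (0 :: real^'n) (1 / 2 ^ N)"
proof
  fix x :: "real^'n" assume x: "x \<in> block p j"
  have "(1 / 2 ^ j :: real) \<le> 1 / 2 ^ N"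
    using assms(2) by (simp add: field_simps)
  moreover have "3 / (4 * 2 ^ j :: real) < 1 / 2 ^ j" by (simp add: field_simps)
  moreover have "0 < 1 / (2 * 2 ^ j :: real)" by simp
  ultimately have "0 \<le> x $ i \<and> x $ i < 1 / 2 ^ N" for i
    using block_bounds[OF assms(1) x, of i] by linarith
  then show "x \<in> half_open_cube 0 (1 / 2 ^ N)" by (simp add: half_open_cube_def)
qed

text \<open>All coordinates of a point of a later block are below three quarters of the lower bound for the
coordinates in block \<open>j\<close>.\<close>

lemma block_separation:
  fixes x y :: "real^'n"
  assumes p: "1 < p" and x: "x \<in> block p j" and y: "y \<in> block p l" and jl: "j < l"
  shows "1 / (8 * 2 ^ j) < x $ i - y $ i"
proof -
  have "(2 ^ Suc j :: real) \<le> 2 ^ l" using jl by (intro power_increasing) auto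
  then have "3 / (4 * 2 ^ l) \<le> 3 / (8 * 2 ^ j :: real)" by (simp add: field_simps)
  moreover have "1 / (2 * 2 ^ j) = 3 / (8 * 2 ^ j) + 1 / (8 * 2 ^ j :: real)" by (simp add: field_simps)
  ultimately show ?thesis
    using block_bounds(1)[OF p x, of i] block_bounds(2)[OF p y, of i] by linarith
qed

lemma block_disjoint:
  fixes x :: "real^'n"
  assumes p: "1 < p" and "x \<in> block p j" "x \<in> block p l"
  shows "j = l"
proof -
  have *: False if "i < k" "x \<in> block p i" "x \<in> block p k" for i k
  proof -
    have "1 / (8 * 2 ^ i) < x $ undefined - x $ undefined"
      by (rule block_separation[OF p that(2,3,1)])
    moreover have "0 < 1 / (8 * 2 ^ i :: real)" by simp
    ultimately show False by linarith
  qed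
  show ?thesis
  proof (cases j l rule: linorder_cases)
    case less
    then show ?thesis using *[OF _ assms(2,3)] by simp
  next
    case greater
    then show ?thesis using *[OF _ assms(3,2)] by simp
  qed
qed

lemma indicator_block:
  fixes x :: "real^'n"
  assumes p: "1 < p" and x: "x \<in> block p j"
  shows "indicator (block p l) x = (if l = j then 1 else 0)"
proof (cases "l = j")
  case False
  have "x \<notin> block p l"
  proof
    assume "x \<in> block p l"
    then have "j = l" by (rule block_disjoint[OF p x])
    with False show False by simp
  qed
  then have "indicator (block p l) x = 0" by (rule indicator_simps(2))
  with False show ?thesis by (simp only: if_False)
next
  case True
  from x show ?thesis by (simp only: True indicator_simps if_True refl)
qed

lemma suminf_indicator_block:
  fixes x :: "real^'n" and c :: "nat \<Rightarrow> ennreal"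
  assumes p: "1 < p" and x: "x \<in> block p j"
  shows "(\<Sum>l. c l * indicator (block p l) x) = c j"
proof -
  have "(\<lambda>l. c l * indicator (block p l) x) = (\<lambda>l. if l = j then c l else 0)"
    by (rule ext) (simp add: indicator_block[OF p x])
  then have "(\<lambda>l. c l * indicator (block p l) x) sums c j"
    by (simp only: sums_single)
  then show ?thesis by (rule sums_unique[symmetric])
qed

definition block_weight :: "real \<Rightarrow> real^'n \<Rightarrow> real" where
  "block_weight p x = (\<Sum>j. mass p j / block_volume TYPE('n) p j * indicator (block p j) x)"

lemma block_weight_on_block:
  fixes x :: "real^'n"
  assumes p: "1 < p" and x: "x \<in> block p j"
  shows "block_weight p x = mass p j / block_volume TYPE('n) p j"
proof -
  let ?c = "\<lambda>l. mass p l / block_volume TYPE('n) p l"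
  have "(\<lambda>l. ?c l * indicator (block p l) x) = (\<lambda>l. if l = j then ?c l else 0)"
    by (rule ext) (simp add: indicator_block[OF p x])
  then have "(\<lambda>l. ?c l * indicator (block p l) x) sums ?c j"
    using sums_single[of j ?c] by (simp only:)
  then show ?thesis unfolding block_weight_def by (rule sums_unique[symmetric])
qed

lemma block_weight_off_blocks:
  assumes "\<And>j. x \<notin> block p j"
  shows "block_weight p x = 0"
  using assms by (simp add: block_weight_def)

lemma block_weight_pos:
  fixes x :: "real^'n"
  assumes p: "1 < p" and x: "x \<in> block p j"
  shows "0 < block_weight p x"
  using mass_pos[OF p] block_volume_pos[OF p, where 'n = 'n] by (simp add: block_weight_on_block[OF p x])

lemma block_weight_nonneg:
  fixes x :: "real^'n"
  assumes p: "1 < p"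
  shows "0 \<le> block_weight p x"
proof (cases "\<exists>j. x \<in> block p j")
  case True
  then obtain j where "x \<in> block p j" by blast
  from block_weight_pos[OF p this] show ?thesis by simp
qed (simp add: block_weight_off_blocks)

lemma ennreal_block_weight:
  fixes x :: "real^'n"
  assumes p: "1 < p"
  shows "ennreal (block_weight p x)
    = (\<Sum>j. ennreal (mass p j / block_volume TYPE('n) p j) * indicator (block p j) x)"
proof (cases "\<exists>j. x \<in> block p j")
  case True
  then obtain j where "x \<in> block p j" by blast
  then show ?thesis using p by (simp add: suminf_indicator_block block_weight_on_block)
next
  case False
  then show ?thesis by (simp add: block_weight_off_blocks)
qed

lemma nn_integral_block_weight:
  fixes g :: "real^'n \<Rightarrow> ennreal"
  assumes p: "1 < p" and [measurable]: "g \<in> borel_measurable lebesgue"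
  shows "(\<integral>\<^sup>+x. g x * ennreal (block_weight p x) \<partial>lebesgue)
    = (\<Sum>j. ennreal (mass p j / block_volume TYPE('n) p j) * (\<integral>\<^sup>+x\<in>block p j. g x \<partial>lebesgue))"
proof -
  have "(\<integral>\<^sup>+x. g x * ennreal (block_weight p x) \<partial>lebesgue)
    = (\<integral>\<^sup>+x. (\<Sum>j. ennreal (mass p j / block_volume TYPE('n) p j) * (g x * indicator (block p j) x)) \<partial>lebesgue)"
    unfolding ennreal_block_weight[OF p] ennreal_suminf_cmult[symmetric]
    by (simp only: mult.left_commute)
  also have "\<dots> = (\<Sum>j. \<integral>\<^sup>+x. ennreal (mass p j / block_volume TYPE('n) p j) * (g x * indicator (block p j) x) \<partial>lebesgue)"
    by (rule nn_integral_suminf) measurable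
  also have "\<dots> = (\<Sum>j. ennreal (mass p j / block_volume TYPE('n) p j) * (\<integral>\<^sup>+x\<in>block p j. g x \<partial>lebesgue))"
    by (intro suminf_cong nn_integral_cmult) measurable
  finally show ?thesis .
qed

lemma nn_integral_const_block:
  assumes p: "1 < p"
  shows "ennreal (mass p j / block_volume TYPE('n) p j) * (\<integral>\<^sup>+x\<in>(block p j :: (real^'n) set). t \<partial>lebesgue)
    = t * ennreal (mass p j)"
proof -
  have pos: "0 < mass p j" "0 < block_volume TYPE('n) p j"
    using p by (simp_all add: mass_pos block_volume_pos)
  have "(\<integral>\<^sup>+x\<in>(block p j :: (real^'n) set). t \<partial>lebesgue) = t * ennreal (block_volume TYPE('n) p j)"
    by (subst nn_integral_cmult_indicator) (simp_all only: block_sets emeasure_block[OF p])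
  moreover have "ennreal (mass p j / block_volume TYPE('n) p j) * ennreal (block_volume TYPE('n) p j) = ennreal (mass p j)"
    using pos by (simp add: ennreal_mult[symmetric])
  ultimately show ?thesis by (metis mult.left_commute)
qed

lemma block_weight_measurable [measurable]: 
  "(block_weight p :: real^'n \<Rightarrow> real) \<in> borel_measurable lebesgue"
  unfolding block_weight_def by measurable

lemma weight_block_weight:
  assumes p: "1 < p"
  shows "weight (block_weight p :: real^'n \<Rightarrow> real)"
  unfolding weight_def
proof (intro conjI allI impI)
  show "0 \<le> block_weight p x" for x :: "real^'n" using p by (rule block_weight_nonneg)
  fix K :: "(real^'n) set" assume K: "compact K"
  have "(\<integral>\<^sup>+x. ennreal (block_weight p (x :: real^'n)) \<partial>lebesgue)
    = (\<Sum>j. ennreal (mass p j / block_volume TYPE('n) p j) * (\<integral>\<^sup>+x\<in>(block p j :: (real^'n) set). 1 \<partial>lebesgue))"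
    using nn_integral_block_weight[OF p, of "\<lambda>_. 1"] by simp
  also have "\<dots> = (\<Sum>j. ennreal (mass p j))"
    by (subst nn_integral_const_block[OF p]) simp
  also have "\<dots> = ennreal (tail_mass p 0)"
    using mass_sums_tail[OF p, of 0] mass_pos[OF p] by (intro suminf_ennreal_eq) (auto simp: less_imp_le)
  finally have "integrable lebesgue (block_weight p :: real^'n \<Rightarrow> real)"
    using block_weight_nonneg[OF p] by (intro integrableI_nonneg) auto
  then show "set_integrable lebesgue K (block_weight p)"
    unfolding set_integrable_def using K
    by (intro integrable_mult_indicator) (auto simp: compact_imp_closed)
qed

section \<open>Boundedness of the maximal operator\<close>

text \<open>Either \<open>t \<le> A\<close> or \<open>t\<^bsup>1-p\<^esup> \<le> A\<^bsup>1-p\<^esup>\<close>. With a good choice of \<open>A\<close> this replaces Hoelder's inequality.\<close>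

lemma young_split:
  assumes p: "1 < p" and A: "0 < A"
  shows "t \<le> ennreal A + ennreal (A powr (1 - p)) * ennreal_powr t p"
proof (cases t)
  case (real a)
  show ?thesis
  proof (cases "a \<le> A")
    case True
    then have "t \<le> ennreal A" using real by (simp add: ennreal_leI)
    then show ?thesis by (rule order_trans) simp
  next
    case False
    then have a: "A < a" "0 < a" using A by auto
    have "a = a powr (1 - p) * a powr p"
      using a by (simp only: powr_add[symmetric]) simp
    also have "\<dots> \<le> A powr (1 - p) * a powr p"
      using a A p by (intro mult_right_mono powr_mono2') auto
    finally have "t \<le> ennreal (A powr (1 - p)) * ennreal_powr t p"
      using real by (simp add: ennreal_mult[symmetric] ennreal_leI)
    then show ?thesis by (rule order_trans) simp
  qed
next
  case top
  then show ?thesis using A by (simp add: ennreal_mult_top)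
qed

text \<open>This is the bound \<open>G\<^sub>l \<lesssim> J\<^bsup>1/p\<^esup>\<close> of the introduction. The powers of the mass in the weight and in the
volume of the block cancel, which is why the volume was chosen as it was.\<close>

lemma block_integral_le:
  fixes g :: "real^'n \<Rightarrow> ennreal"
  assumes p: "1 < p" and J: "0 < J" and [measurable]: "g \<in> borel_measurable lebesgue"
    and bound: "(\<integral>\<^sup>+x. ennreal_powr (g x) p * ennreal (block_weight p x) \<partial>lebesgue) \<le> ennreal J"
  shows "(\<integral>\<^sup>+x\<in>block p l. g x \<partial>lebesgue) \<le> ennreal (2 * J powr (1 / p) / (4 * 2 ^ l) ^ CARD('n))"
proof -
  define m where "m = mass p l"
  have m: "0 < m" using p by (simp add: m_def mass_pos)
  define v where "v = block_volume TYPE('n) p l"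
  have v: "0 < v" using p by (simp add: v_def block_volume_pos)
  \<comment> \<open>This \<open>A\<close> makes the two terms of \<open>young_split\<close> contribute equally.\<close>
  define A where "A = (J / m) powr (1 / p)"
  have A: "0 < A" using J m by (simp add: A_def)
  have Ap: "A powr p = J / m" using J m p by (simp add: A_def powr_powr)
  let ?I = "\<integral>\<^sup>+x\<in>block p l. ennreal_powr (g x) p \<partial>lebesgue"
  have "ennreal (m / v) * ?I \<le> (\<Sum>j. ennreal (mass p j / block_volume TYPE('n) p j)
      * (\<integral>\<^sup>+x\<in>block p j. ennreal_powr (g x) p \<partial>lebesgue))"
    unfolding m_def v_def
    using sum_le_suminf[of "\<lambda>j. ennreal (mass p j / block_volume TYPE('n) p j)
      * (\<integral>\<^sup>+x\<in>block p j. ennreal_powr (g x) p \<partial>lebesgue)" "{l}"] by simp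
  also have "\<dots> \<le> ennreal J"
    using bound by (subst (asm) nn_integral_block_weight[OF p]) measurable
  finally have "ennreal (v / m) * (ennreal (m / v) * ?I) \<le> ennreal (v / m) * ennreal J"
    by (rule mult_left_mono) simp
  moreover have "ennreal (v / m) * (ennreal (m / v) * ?I) = ?I"
    using m v by (simp add: mult.assoc[symmetric] ennreal_mult[symmetric])
  ultimately have I: "?I \<le> ennreal (v * (J / m))"
    using m v J by (simp add: ennreal_mult[symmetric])
  have "(\<integral>\<^sup>+x\<in>block p l. g x \<partial>lebesgue)
    \<le> (\<integral>\<^sup>+x. ennreal A * indicator (block p l) x
          + ennreal (A powr (1 - p)) * (ennreal_powr (g x) p * indicator (block p l) x) \<partial>lebesgue)"
    using young_split[OF p A] by (intro nn_integral_mono) (auto split: split_indicator)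
  also have "\<dots> = ennreal A * ennreal v + ennreal (A powr (1 - p)) * ?I"
    by (subst nn_integral_add, measurable)
       (simp add: nn_integral_cmult nn_integral_cmult_indicator emeasure_block[OF p] v_def del: emeasure_completion)
  also have "\<dots> \<le> ennreal A * ennreal v + ennreal (A powr (1 - p)) * ennreal (v * A powr p)"
    unfolding Ap using I by (intro add_left_mono mult_left_mono) auto
  also have "\<dots> = ennreal (A * v + A powr (1 - p) * (v * A powr p))"
    using A v by (subst ennreal_plus) (simp_all add: ennreal_mult)
  also have "A powr (1 - p) * (v * A powr p) = A * v"
  proof -
    have "A powr (1 - p) * A powr p = A"
      using A by (simp only: powr_add[symmetric]) simp
    then show ?thesis by (metis mult.left_commute mult.commute)
  qed
  also have "A * v = J powr (1 / p) / (4 * 2 ^ l) ^ CARD('n)"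
    using J m by (simp add: A_def v_def block_volume_def powr_divide m_def[symmetric])
  finally show ?thesis by simp
qed

text \<open>Successive bounds decrease by the factor \<open>2\<^bsup>-n\<^esup> \<le> 1/2\<close>.\<close>

lemma geometric_tail_le:
  fixes b :: "nat \<Rightarrow> ennreal"
  assumes B: "0 \<le> B" and n: "0 < n"
    and small: "\<And>l. l < i \<Longrightarrow> b l = 0"
    and le: "\<And>l. b l \<le> ennreal (B / (4 * 2 ^ l) ^ n)"
  shows "(\<Sum>l. b l) \<le> ennreal (2 * B / (4 * 2 ^ i) ^ n)"
proof -
  define c where "c = B / (4 * 2 ^ i) ^ n"
  have c: "0 \<le> c" using B by (simp add: c_def)
  define h where "h l = (if l < i then 0 else (1 / 2) ^ (l - i) :: real)" for l
  have "(\<lambda>m. h (m + i)) sums 2"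
    using geometric_sums[of "1 / 2 :: real"] by (simp add: h_def)
  then have "h sums (2 + (\<Sum>l<i. h l))" by (simp only: sums_iff_shift)
  then have "h sums 2" by (simp add: h_def)
  then have hs: "(\<lambda>l. c * h l) sums (c * 2)" by (rule sums_mult)
  have "b l \<le> ennreal (c * h l)" for l
  proof (cases "l < i")
    case False
    then obtain m where l: "l = i + m" by (metis le_add_diff_inverse not_less)
    have "(2 ^ m :: real) \<le> (2 ^ m) ^ n"
      using n power_increasing[of 1 n "2 ^ m :: real"] by simp
    then have "B / ((4 * 2 ^ i) ^ n * (2 ^ m) ^ n) \<le> B / ((4 * 2 ^ i) ^ n * 2 ^ m)"
      using B by (intro divide_left_mono mult_left_mono) auto
    then have "B / (4 * 2 ^ l) ^ n \<le> c * h l"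
      by (simp add: l c_def h_def power_add power_mult_distrib power_one_over field_simps)
    then show ?thesis using le[of l] ennreal_leI order_trans by blast
  qed (simp add: small)
  then have "(\<Sum>l. b l) \<le> (\<Sum>l. ennreal (c * h l))"
    by (intro suminf_le) auto
  also have "\<dots> = ennreal (c * 2)"
    using hs c by (intro suminf_ennreal_eq) (auto simp: h_def)
  finally show ?thesis by (simp add: c_def mult.commute)
qed

text \<open>Let \<open>i\<close> be the first block met by the cube. If the cube meets blocks other than \<open>j\<close>, it meets two
blocks, the first of them \<open>i\<close>, so by separation its side is comparable to \<open>2\<^bsup>-i\<^esup>\<close> or larger; the integrals
over the blocks from \<open>i\<close> on are dominated by a geometric series of size \<open>2\<^bsup>-in\<^esup>\<close>.\<close>

lemma other_blocks_integral_le: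
  fixes g :: "real^'n \<Rightarrow> ennreal"
  assumes p: "1 < p" and B: "0 \<le> B" and s: "0 < s"
    and x: "x \<in> half_open_cube a s" "x \<in> block p j"
    and g: "\<And>l. (\<integral>\<^sup>+y\<in>block p l. g y \<partial>lebesgue) \<le> ennreal (B / (4 * 2 ^ l) ^ CARD('n))"
  shows "(\<Sum>l. if l = j then 0 else \<integral>\<^sup>+y\<in>half_open_cube a s \<inter> block p l. g y \<partial>lebesgue)
    \<le> ennreal (2 * B * (2 * s) ^ CARD('n))"
proof -
  let ?Q = "half_open_cube a s"
  let ?b = "\<lambda>l. if l = j then 0 else \<integral>\<^sup>+y\<in>?Q \<inter> block p l. g y \<partial>lebesgue"
  show ?thesis
  proof (cases "\<exists>l. l \<noteq> j \<and> ?Q \<inter> block p l \<noteq> {}")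
    case False
    then have "?b l = 0" for l by auto
    then show ?thesis by simp
  next
    case True
    then obtain k where k: "k \<noteq> j" "?Q \<inter> block p k \<noteq> {}" by blast
    have j: "?Q \<inter> block p j \<noteq> {}" using x by blast
    define i where "i = (LEAST l. ?Q \<inter> block p l \<noteq> {})"
    have i: "?Q \<inter> block p i \<noteq> {}" unfolding i_def using j by (rule LeastI)
    have least: "?Q \<inter> block p l = {}" if "l < i" for l
      using not_less_Least[of l "\<lambda>l. ?Q \<inter> block p l \<noteq> {}"] that unfolding i_def by blast
    have "i \<le> j" "i \<le> k" using least[of j] least[of k] j k(2) by (meson not_le)+
    then obtain l where l: "i < l" "?Q \<inter> block p l \<noteq> {}"
    proof (cases "i = j")
      case True
      with \<open>i \<le> k\<close> k show ?thesis by (intro that[of k]) auto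
    next
      case False
      with \<open>i \<le> j\<close> j show ?thesis by (intro that[of j]) auto
    qed
    obtain y where y: "y \<in> ?Q" "y \<in> block p i" using i by blast
    obtain z where z: "z \<in> ?Q" "z \<in> block p l" using l by blast
    have "1 / (8 * 2 ^ i) < s"
      using block_separation[OF p y(2) z(2) l(1), of undefined]
        half_open_cube_dist_component[OF y(1) z(1), of undefined] by linarith
    then have s': "1 / (4 * 2 ^ i) \<le> 2 * s" by (simp add: field_simps)
    have "(\<Sum>l. ?b l) \<le> ennreal (2 * B / (4 * 2 ^ i) ^ CARD('n))"
    proof (rule geometric_tail_le[OF B])
      show "?b l = 0" if "l < i" for l using least[OF that] by simp
      show "?b l \<le> ennreal (B / (4 * 2 ^ l) ^ CARD('n))" for l
      proof -
        have "(\<integral>\<^sup>+y\<in>?Q \<inter> block p l. g y \<partial>lebesgue) \<le> (\<integral>\<^sup>+y\<in>block p l. g y \<partial>lebesgue)"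
          by (intro nn_integral_mono) (auto split: split_indicator)
        also note g[of l]
        finally show ?thesis by simp
      qed
    qed simp
    also have "\<dots> = ennreal (2 * B * (1 / (4 * 2 ^ i)) ^ CARD('n))"
      by (simp add: power_one_over)
    also have "\<dots> \<le> ennreal (2 * B * (2 * s) ^ CARD('n))"
      using s' B by (intro ennreal_leI mult_left_mono power_mono) auto
    finally show ?thesis .
  qed
qed

text \<open>The integral over a cube splits into the part on the block of \<open>x\<close>, controlled by the unweighted
maximal function, and the part on the other blocks, controlled by a constant.\<close>

lemma cube_average_on_block_le:
  fixes g :: "real^'n \<Rightarrow> ennreal"
  assumes p: "1 < p" and B: "0 \<le> B" and s: "0 < s"
    and x: "x \<in> half_open_cube a s" "x \<in> block p j"
    and g_meas [measurable]: "g \<in> borel_measurable lebesgue"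
    and supp: "AE y in lebesgue. g y \<noteq> 0 \<longrightarrow> 0 < block_weight p y"
    and g: "\<And>l. (\<integral>\<^sup>+y\<in>block p l. g y \<partial>lebesgue) \<le> ennreal (B / (4 * 2 ^ l) ^ CARD('n))"
  shows "cube_average (half_open_cube a s) g
    \<le> ennreal (cube_ball_ratio TYPE('n)) * ball_maximal (\<lambda>y. g y * indicator (block p j) y) x
      + ennreal (2 * B * 2 ^ CARD('n))"
proof -
  let ?Q = "half_open_cube a s"
  let ?h = "\<lambda>y. g y * indicator (block p j) y"
  let ?b = "\<lambda>l. if l = j then 0 else \<integral>\<^sup>+y\<in>?Q \<inter> block p l. g y \<partial>lebesgue"
  have "(\<integral>\<^sup>+y\<in>?Q. g y \<partial>lebesgue)
      = (\<integral>\<^sup>+y. (\<Sum>l. (g y * indicator ?Q y) * indicator (block p l) y) \<partial>lebesgue)"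
  proof (rule nn_integral_cong_AE, use supp in eventually_elim)
    fix y assume y: "g y \<noteq> 0 \<longrightarrow> 0 < block_weight p y"
    show "g y * indicator ?Q y = (\<Sum>l. (g y * indicator ?Q y) * indicator (block p l) y)"
    proof (cases "\<exists>l. y \<in> block p l")
      case True
      then obtain l where "y \<in> block p l" by blast
      from suminf_indicator_block[OF p this, of "\<lambda>_. g y * indicator ?Q y"] show ?thesis by simp
    next
      case False
      then have "g y = 0" using y block_weight_off_blocks[of y p] by auto
      then show ?thesis by simp
    qed
  qed
  also have "\<dots> = (\<Sum>l. \<integral>\<^sup>+y. (g y * indicator ?Q y) * indicator (block p l) y \<partial>lebesgue)"
    by (rule nn_integral_suminf) measurable
  also have "\<dots> = (\<Sum>l. (if l = j then \<integral>\<^sup>+y\<in>?Q. ?h y \<partial>lebesgue else 0) + ?b l)"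
    by (intro suminf_cong) (auto intro!: nn_integral_cong split: split_indicator)
  also have "\<dots> = (\<integral>\<^sup>+y\<in>?Q. ?h y \<partial>lebesgue) + (\<Sum>l. ?b l)"
    by (subst suminf_add[symmetric]) (simp_all add: sums_unique[OF sums_single, symmetric])
  also have "\<dots> \<le> (\<integral>\<^sup>+y\<in>?Q. ?h y \<partial>lebesgue) + ennreal (2 * B * (2 * s) ^ CARD('n))"
    by (intro add_left_mono other_blocks_integral_le[OF p B s x g])
  finally have "cube_average ?Q g
      \<le> cube_average ?Q ?h + ennreal (2 * B * (2 * s) ^ CARD('n)) / emeasure lebesgue ?Q"
    unfolding cube_average_def add_divide_distrib_ennreal[symmetric] by (rule divide_right_mono_ennreal)
  also have "ennreal (2 * B * (2 * s) ^ CARD('n)) / emeasure lebesgue ?Q = ennreal (2 * B * 2 ^ CARD('n))"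
    unfolding emeasure_half_open_cube[OF s] using s B
    by (subst divide_ennreal) (auto simp: power_mult_distrib)
  also have "cube_average ?Q ?h + \<dots>
      \<le> ennreal (cube_ball_ratio TYPE('n)) * ball_maximal ?h x + \<dots>"
    by (intro add_right_mono cube_average_le_ball_maximal s x)
  finally show ?thesis .
qed

lemma suminf_mass:
  assumes p: "1 < p"
  shows "(\<Sum>j. ennreal (mass p j)) = 1"
proof -
  have "(\<Sum>j. ennreal (mass p j)) = ennreal (tail_mass p 0)"
    using mass_sums_tail[OF p, of 0] mass_pos[OF p] by (intro suminf_ennreal_eq) (auto simp: less_imp_le)
  then show ?thesis by (simp add: tail_mass_def)
qed

lemma ennreal_distrib_regroup:
  assumes "0 \<le> a" "0 \<le> b" "0 \<le> d" "0 \<le> e"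
  shows "ennreal a * (ennreal b * t + ennreal (d * e)) = ennreal (a * b) * t + ennreal (a * d * e)"
  using assms by (simp add: distrib_left ennreal_mult mult.assoc)

text \<open>The bound \<open>J\<close> for the weighted integral is taken positive because it enters the choice of \<open>A\<close> in
\<open>block_integral_le\<close> as a divisor and a base of powers; equality is recovered by letting \<open>J\<close> decrease to the
integral.\<close>

lemma maximal_operator_weighted_integral_le:
  fixes p :: real
  assumes p: "1 < p"
  obtains K where "0 < K" "\<And>(f :: real^'n \<Rightarrow> real) J. f \<in> borel_measurable lebesgue \<Longrightarrow>
      AE y in lebesgue. f y \<noteq> 0 \<longrightarrow> 0 < block_weight p y \<Longrightarrow> 0 < J \<Longrightarrow>
      (\<integral>\<^sup>+x. ennreal_powr (ennreal \<bar>f x\<bar>) p * ennreal (block_weight p x) \<partial>lebesgue) \<le> ennreal J \<Longrightarrow>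
      (\<integral>\<^sup>+x. ennreal_powr (maximal_operator f x) p * ennreal (block_weight p x) \<partial>lebesgue) \<le> ennreal (K * J)"
proof -
  obtain C where C: "0 < C" "\<And>g :: real^'n \<Rightarrow> ennreal. g \<in> borel_measurable lebesgue \<Longrightarrow>
      (\<integral>\<^sup>+x. ennreal_powr (ball_maximal g x) p \<partial>lebesgue)
        \<le> ennreal C * (\<integral>\<^sup>+x. ennreal_powr (g x) p \<partial>lebesgue)"
    by (rule ball_maximal_strong_type[OF p]) (rule that)
  define R where "R = cube_ball_ratio TYPE('n)"
  have R: "0 < R" by (simp add: R_def cube_ball_ratio_pos)
  define K1 where "K1 = 2 powr p * R powr p"
  have K1: "0 < K1" using R by (simp add: K1_def)
  define D where "D = (4 * 2 ^ CARD('n) :: real)"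
  have D: "0 < D" by (simp add: D_def)
  define K2 where "K2 = 2 powr p * D powr p"
  have K2: "0 < K2" using D by (simp add: K2_def)
  show ?thesis
  proof (rule that[of "K1 * C + K2"])
    show "0 < K1 * C + K2" using K1 K2 C by (simp add: add_pos_pos)
    fix f :: "real^'n \<Rightarrow> real" and J :: real
    assume f [measurable]: "f \<in> borel_measurable lebesgue"
      and supp: "AE y in lebesgue. f y \<noteq> 0 \<longrightarrow> 0 < block_weight p y"
      and J: "0 < J"
      and bound: "(\<integral>\<^sup>+x. ennreal_powr (ennreal \<bar>f x\<bar>) p * ennreal (block_weight p x) \<partial>lebesgue) \<le> ennreal J"
    define g where "g x = ennreal \<bar>f x\<bar>" for x
    have g [measurable]: "g \<in> borel_measurable lebesgue" unfolding g_def by measurable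
    define c where "c j = ennreal (mass p j / block_volume TYPE('n) p j)" for j
    define h where "h j y = g y * indicator (block p j) y" for j y
    have h [measurable]: "h j \<in> borel_measurable lebesgue" for j unfolding h_def by measurable
    have gsupp: "AE y in lebesgue. g y \<noteq> 0 \<longrightarrow> 0 < block_weight p y"
      using supp by eventually_elim (auto simp: g_def)
    define B where "B = 2 * J powr (1 / p)"
    have B: "0 \<le> B" by (simp add: B_def)
    have gblock: "(\<integral>\<^sup>+y\<in>block p l. g y \<partial>lebesgue) \<le> ennreal (B / (4 * 2 ^ l) ^ CARD('n))" for l
      unfolding B_def using bound unfolding g_def[symmetric] by (rule block_integral_le[OF p J g])
    let ?F = "\<lambda>j x. ennreal K1 * ennreal_powr (ball_maximal (h j) x) p + ennreal (K2 * J)"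
    have point: "ennreal_powr (maximal_operator f x) p \<le> ?F j x" if x: "x \<in> block p j" for x j
    proof -
      have "maximal_operator f x \<le> ennreal R * ball_maximal (h j) x + ennreal (2 * B * 2 ^ CARD('n))"
        unfolding maximal_operator_def g_def[symmetric]
      proof (rule SUP_least)
        fix Q assume "Q \<in> {Q \<in> cubes. x \<in> Q}"
        then obtain a s where Q: "Q = half_open_cube a s" "0 < s" "x \<in> half_open_cube a s"
          by (auto simp: cubes_def)
        show "cube_average Q g \<le> ennreal R * ball_maximal (h j) x + ennreal (2 * B * 2 ^ CARD('n))"
          unfolding Q(1) R_def h_def by (rule cube_average_on_block_le[OF p B Q(2,3) x g gsupp gblock])
      qed
      then have "ennreal_powr (maximal_operator f x) p
        \<le> ennreal_powr (ennreal R * ball_maximal (h j) x + ennreal (2 * B * 2 ^ CARD('n))) p"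
        using p by (intro ennreal_powr_mono) auto
      also have "\<dots> \<le> ennreal (2 powr p) * (ennreal_powr (ennreal R * ball_maximal (h j) x) p
          + ennreal_powr (ennreal (2 * B * 2 ^ CARD('n))) p)"
        using p by (intro ennreal_powr_add_le) auto
      also have "ennreal_powr (ennreal R * ball_maximal (h j) x) p
          = ennreal (R powr p) * ennreal_powr (ball_maximal (h j) x) p"
        using p R by (intro ennreal_powr_cmult) auto
      also have "ennreal_powr (ennreal (2 * B * 2 ^ CARD('n))) p = ennreal (D powr p * J)"
      proof -
        have "2 * B * 2 ^ CARD('n) = D * J powr (1 / p)" by (simp add: B_def D_def)
        moreover have "(D * J powr (1 / p)) powr p = D powr p * J"
          using p J D by (simp add: powr_mult powr_powr)
        ultimately show ?thesis using D by simp
      qed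
      also have "ennreal (2 powr p) * (ennreal (R powr p) * ennreal_powr (ball_maximal (h j) x) p
          + ennreal (D powr p * J)) = ?F j x"
        unfolding K1_def K2_def using J by (intro ennreal_distrib_regroup) auto
      finally show ?thesis .
    qed
    have "(\<integral>\<^sup>+x. ennreal_powr (maximal_operator f x) p * ennreal (block_weight p x) \<partial>lebesgue)
      \<le> (\<integral>\<^sup>+x. (\<Sum>j. c j * (?F j x * indicator (block p j) x)) \<partial>lebesgue)"
    proof (rule nn_integral_mono)
      fix x :: "real^'n"
      show "ennreal_powr (maximal_operator f x) p * ennreal (block_weight p x)
        \<le> (\<Sum>j. c j * (?F j x * indicator (block p j) x))"
      proof (cases "\<exists>j. x \<in> block p j")
        case True
        then obtain j where x: "x \<in> block p j" by blast
        have "(\<Sum>j. (c j * ?F j x) * indicator (block p j) x) = c j * ?F j x"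
          by (rule suminf_indicator_block[OF p x])
        moreover have "ennreal_powr (maximal_operator f x) p * ennreal (block_weight p x) \<le> ?F j x * c j"
          unfolding c_def block_weight_on_block[OF p x] by (rule mult_right_mono[OF point[OF x]]) simp
        ultimately show ?thesis by (simp only: mult.assoc mult.commute[of "?F j x" "c j"])
      next
        case False
        then show ?thesis by (simp add: block_weight_off_blocks)
      qed
    qed
    also have "\<dots> = (\<Sum>j. \<integral>\<^sup>+x. c j * (?F j x * indicator (block p j) x) \<partial>lebesgue)"
      by (rule nn_integral_suminf) measurable
    also have "\<dots> \<le> (\<Sum>j. ennreal (K1 * C) * (c j * (\<integral>\<^sup>+x\<in>block p j. ennreal_powr (g x) p \<partial>lebesgue))
        + ennreal (K2 * J) * ennreal (mass p j))"
    proof (intro suminf_le allI)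
      fix j
      have "(\<integral>\<^sup>+x. c j * (?F j x * indicator (block p j) x) \<partial>lebesgue)
        \<le> (\<integral>\<^sup>+x. c j * (ennreal K1 * ennreal_powr (ball_maximal (h j) x) p)
             + c j * (ennreal (K2 * J) * indicator (block p j) x) \<partial>lebesgue)"
        by (rule nn_integral_mono) (auto simp: distrib_left split: split_indicator)
      also have "\<dots> = c j * (ennreal K1 * (\<integral>\<^sup>+x. ennreal_powr (ball_maximal (h j) x) p \<partial>lebesgue))
          + c j * (\<integral>\<^sup>+x\<in>(block p j :: (real^'n) set). ennreal (K2 * J) \<partial>lebesgue)"
        by (subst nn_integral_add, measurable) (simp add: nn_integral_cmult)
      also have "c j * (\<integral>\<^sup>+x\<in>(block p j :: (real^'n) set). ennreal (K2 * J) \<partial>lebesgue)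
          = ennreal (K2 * J) * ennreal (mass p j)"
        unfolding c_def by (rule nn_integral_const_block[OF p])
      also have "c j * (ennreal K1 * (\<integral>\<^sup>+x. ennreal_powr (ball_maximal (h j) x) p \<partial>lebesgue))
          \<le> c j * (ennreal K1 * (ennreal C * (\<integral>\<^sup>+x. ennreal_powr (h j x) p \<partial>lebesgue)))"
        by (intro mult_left_mono C(2)) (auto intro: h)
      also have "(\<integral>\<^sup>+x. ennreal_powr (h j x) p \<partial>lebesgue) = (\<integral>\<^sup>+x\<in>block p j. ennreal_powr (g x) p \<partial>lebesgue)"
        by (rule nn_integral_cong) (auto simp: h_def split: split_indicator)
      also have "c j * (ennreal K1 * (ennreal C * (\<integral>\<^sup>+x\<in>block p j. ennreal_powr (g x) p \<partial>lebesgue)))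
          = ennreal (K1 * C) * (c j * (\<integral>\<^sup>+x\<in>block p j. ennreal_powr (g x) p \<partial>lebesgue))"
        using K1 C(1) by (simp add: ennreal_mult[of K1 C] mult.assoc mult.left_commute[of "c j"])
      finally show "(\<integral>\<^sup>+x. c j * (?F j x * indicator (block p j) x) \<partial>lebesgue)
        \<le> ennreal (K1 * C) * (c j * (\<integral>\<^sup>+x\<in>block p j. ennreal_powr (g x) p \<partial>lebesgue))
          + ennreal (K2 * J) * ennreal (mass p j)" by (simp add: add_right_mono)
    qed auto
    also have "\<dots> = ennreal (K1 * C) * (\<Sum>j. c j * (\<integral>\<^sup>+x\<in>block p j. ennreal_powr (g x) p \<partial>lebesgue))
        + ennreal (K2 * J)"
      by (subst suminf_add[symmetric]) (simp_all add: suminf_mass[OF p])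
    also have "(\<Sum>j. c j * (\<integral>\<^sup>+x\<in>block p j. ennreal_powr (g x) p \<partial>lebesgue))
       = (\<integral>\<^sup>+x. ennreal_powr (g x) p * ennreal (block_weight p x) \<partial>lebesgue)"
      unfolding c_def by (rule nn_integral_block_weight[OF p, symmetric]) measurable
    also have "ennreal (K1 * C) * \<dots> + ennreal (K2 * J) \<le> ennreal (K1 * C) * ennreal J + ennreal (K2 * J)"
      using bound unfolding g_def by (intro add_right_mono mult_left_mono) auto
    also have "\<dots> = ennreal ((K1 * C + K2) * J)"
      using K1 K2 C(1) J by (simp add: ennreal_mult[symmetric] ennreal_plus[symmetric] distrib_right del: ennreal_plus)
    finally show "(\<integral>\<^sup>+x. ennreal_powr (maximal_operator f x) p * ennreal (block_weight p x) \<partial>lebesgue)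
      \<le> ennreal ((K1 * C + K2) * J)" .
  qed
qed

lemma ennreal_le_cmult_if_le_bounds:
  assumes K: "0 < K" and le: "\<And>J. 0 < J \<Longrightarrow> i \<le> ennreal J \<Longrightarrow> m \<le> ennreal (K * J)"
  shows "m \<le> ennreal K * i"
proof (cases i)
  case (real r)
  have "m \<le> ennreal (K * r) + ennreal e" if e: "0 < e" for e
  proof -
    have pos: "0 < r + e / K" using real(1) e K by (intro add_nonneg_pos divide_pos_pos)
    moreover have "i \<le> ennreal (r + e / K)"
      unfolding real(2) using e K by (intro ennreal_leI) simp
    ultimately have "m \<le> ennreal (K * (r + e / K))" by (rule le)
    also have "K * (r + e / K) = K * r + e" using K by (simp add: field_simps)
    also have "ennreal (K * r + e) = ennreal (K * r) + ennreal e"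
      using real(1) e K by (intro ennreal_plus) auto
    finally show ?thesis .
  qed
  then have "m \<le> ennreal (K * r)" by (rule ennreal_le_epsilon)
  also have "\<dots> = ennreal K * i"
    unfolding real(2) using real(1) K by (intro ennreal_mult) auto
  finally show ?thesis .
next
  case top
  then show ?thesis using K by (simp add: ennreal_mult_top)
qed

lemma maximal_operator_bounded:
  assumes p: "1 < p"
  shows "bounded_on_weighted_Lp UNIV p (block_weight p :: real^'n \<Rightarrow> real) maximal_operator"
proof -
  obtain K where K: "0 < K" and le: "\<And>(f :: real^'n \<Rightarrow> real) J. f \<in> borel_measurable lebesgue \<Longrightarrow>
      AE y in lebesgue. f y \<noteq> 0 \<longrightarrow> 0 < block_weight p y \<Longrightarrow> 0 < J \<Longrightarrow>
      (\<integral>\<^sup>+x. ennreal_powr (ennreal \<bar>f x\<bar>) p * ennreal (block_weight p x) \<partial>lebesgue) \<le> ennreal J \<Longrightarrow>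
      (\<integral>\<^sup>+x. ennreal_powr (maximal_operator f x) p * ennreal (block_weight p x) \<partial>lebesgue) \<le> ennreal (K * J)"
    by (rule maximal_operator_weighted_integral_le[OF p]) (rule that)
  show ?thesis
    unfolding bounded_on_weighted_Lp_def
  proof (intro exI[of _ "K powr (1 / p)"] conjI ballI)
    fix f :: "real^'n \<Rightarrow> real" assume f: "f \<in> weighted_Lp p (block_weight p) \<inter> UNIV"
    let ?I = "\<integral>\<^sup>+x. ennreal_powr (ennreal \<bar>f x\<bar>) p * ennreal (block_weight p x) \<partial>lebesgue"
    let ?M = "\<integral>\<^sup>+x. ennreal_powr (maximal_operator f x) p * ennreal (block_weight p x) \<partial>lebesgue"
    have f_meas: "f \<in> borel_measurable lebesgue"
      and supp: "AE y in lebesgue. f y \<noteq> 0 \<longrightarrow> 0 < block_weight p y"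
      using f by (auto simp: weighted_Lp_def)
    have "?M \<le> ennreal K * ?I"
      by (rule ennreal_le_cmult_if_le_bounds[OF K]) (rule le[OF f_meas supp])
    then have "ennreal_powr ?M (1 / p) \<le> ennreal_powr (ennreal K * ?I) (1 / p)"
      using p by (intro ennreal_powr_mono) auto
    also have "\<dots> = ennreal (K powr (1 / p)) * ennreal_powr ?I (1 / p)"
      using p K by (intro ennreal_powr_cmult) auto
    finally show "weighted_norm p (block_weight p) (maximal_operator f)
      \<le> ennreal (K powr (1 / p)) * weighted_norm p (block_weight p) (\<lambda>x. ennreal \<bar>f x\<bar>)"
      by (simp only: weighted_norm_def)
  qed simp
qed

section \<open>Unboundedness of the sparse operator\<close>

text \<open>Here \<open>G\<^sub>j\<close> is the same constant for all \<open>j < m\<close> and vanishes for \<open>j \<ge> m\<close>.\<close>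

definition test_function :: "real \<Rightarrow> nat \<Rightarrow> real^'n \<Rightarrow> real" where
  "test_function p m x = (\<Sum>j<m. mass p j powr (- 1 / p) * indicator (block p j) x)"

lemma test_function_measurable [measurable]:
  "(test_function p m :: real^'n \<Rightarrow> real) \<in> borel_measurable lebesgue"
  unfolding test_function_def by measurable

lemma test_function_nonneg: "0 \<le> test_function p m x"
  unfolding test_function_def by (intro sum_nonneg) simp

lemma test_function_on_block:
  fixes x :: "real^'n"
  assumes p: "1 < p" and x: "x \<in> block p j"
  shows "test_function p m x = (if j < m then mass p j powr (- 1 / p) else 0)"
proof -
  have "test_function p m x = (\<Sum>l<m. if l = j then mass p l powr (- 1 / p) else 0)"
    unfolding test_function_def by (intro sum.cong refl) (simp add: indicator_block[OF p x])
  also have "\<dots> = (if j < m then mass p j powr (- 1 / p) else 0)"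
    by (simp add: sum.delta)
  finally show ?thesis .
qed

lemma test_function_support:
  assumes "test_function p m x \<noteq> 0"
  obtains j where "x \<in> block p j"
proof -
  have "\<exists>j. x \<in> block p j"
  proof (rule ccontr)
    assume "\<nexists>j. x \<in> block p j"
    then have "test_function p m x = 0" by (simp add: test_function_def)
    with assms show False by simp
  qed
  with that show thesis by blast
qed

text \<open>Each of the first \<open>m\<close> blocks contributes its mass times the inverse of its mass.\<close>

lemma test_function_weighted_integral:
  assumes p: "1 < p"
  shows "(\<integral>\<^sup>+x. ennreal_powr (ennreal \<bar>test_function p m (x :: real^'n)\<bar>) p
      * ennreal (block_weight p x) \<partial>lebesgue) = ennreal (real m)"
proof -
  let ?c = "\<lambda>j. ennreal (mass p j / block_volume TYPE('n) p j)"
  have term_eq: "?c j * (\<integral>\<^sup>+x\<in>block p j. ennreal_powr (ennreal \<bar>test_function p m (x :: real^'n)\<bar>) p \<partial>lebesgue)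
     = (if j < m then 1 else 0)" for j
  proof -
    have m: "0 < mass p j" using p by (rule mass_pos)
    have "(mass p j powr - (1 / p)) powr p = mass p j powr (- 1)"
      unfolding powr_powr using p by (intro arg_cong[where f = "\<lambda>t. mass p j powr t"]) simp
    then have eq: "(mass p j powr - (1 / p)) powr p = inverse (mass p j)"
      using m by (simp only: powr_minus powr_one less_imp_le)
    have "(\<integral>\<^sup>+x\<in>block p j. ennreal_powr (ennreal \<bar>test_function p m (x :: real^'n)\<bar>) p \<partial>lebesgue)
      = (\<integral>\<^sup>+x\<in>(block p j :: (real^'n) set). (if j < m then ennreal (inverse (mass p j)) else 0) \<partial>lebesgue)"
    proof (rule nn_integral_cong)
      fix x :: "real^'n"
      show "ennreal_powr (ennreal \<bar>test_function p m x\<bar>) p * indicator (block p j) x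
        = (if j < m then ennreal (inverse (mass p j)) else 0) * indicator (block p j) x"
      proof (cases "x \<in> block p j")
        case True
        then show ?thesis by (simp add: test_function_on_block[OF p True] eq)
      qed simp
    qed
    then have "?c j * (\<integral>\<^sup>+x\<in>block p j. ennreal_powr (ennreal \<bar>test_function p m (x :: real^'n)\<bar>) p \<partial>lebesgue)
      = (if j < m then ennreal (inverse (mass p j)) else 0) * ennreal (mass p j)"
      by (simp only: nn_integral_const_block[OF p])
    also have "\<dots> = (if j < m then 1 else 0)"
      using m by (simp add: ennreal_mult[symmetric])
    finally show ?thesis .
  qed
  have "(\<integral>\<^sup>+x. ennreal_powr (ennreal \<bar>test_function p m (x :: real^'n)\<bar>) p
      * ennreal (block_weight p x) \<partial>lebesgue) = (\<Sum>j. if j < m then 1 else (0 :: ennreal))"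
    by (subst nn_integral_block_weight[OF p], measurable) (simp only: term_eq)
  also have "\<dots> = (\<Sum>j<m. 1)"
    by (subst suminf_finite[of "{..<m}"]) auto
  finally show ?thesis by (simp add: ennreal_of_nat_eq_real_of_nat)
qed

lemma test_function_in_weighted_Lp:
  assumes p: "1 < p"
  shows "(test_function p m :: real^'n \<Rightarrow> real) \<in> weighted_Lp p (block_weight p)"
proof -
  have "test_function p m x \<noteq> 0 \<longrightarrow> 0 < block_weight p x" for x :: "real^'n"
    using block_weight_pos[OF p] by (auto elim!: test_function_support)
  moreover have "weighted_norm p (block_weight p) (\<lambda>x :: real^'n. ennreal \<bar>test_function p m x\<bar>) < \<infinity>"
    unfolding weighted_norm_def test_function_weighted_integral[OF p] by simp
  ultimately show ?thesis by (simp add: weighted_Lp_def)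
qed

text \<open>Cubes of different sides have different volumes.\<close>

lemma inj_corner_cube: "inj (\<lambda>N. half_open_cube (0 :: real^'n) (1 / 2 ^ N))"
proof (rule injI)
  fix M N :: nat
  assume eq: "half_open_cube (0 :: real^'n) (1 / 2 ^ M) = half_open_cube 0 (1 / 2 ^ N)"
  have "ennreal ((1 / 2 ^ M) ^ CARD('n)) = ennreal ((1 / 2 ^ N) ^ CARD('n))"
    using emeasure_half_open_cube[of "1 / 2 ^ M" "0 :: real^'n"]
      emeasure_half_open_cube[of "1 / 2 ^ N" "0 :: real^'n"] by (simp only: eq) simp
  then have "(1 / 2 ^ M :: real) ^ CARD('n) = (1 / 2 ^ N) ^ CARD('n)"
    by (subst (asm) ennreal_inj) auto
  then have "(1 / 2 ^ M :: real) = 1 / 2 ^ N"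
    by (subst (asm) power_eq_iff_eq_base) auto
  then show "M = N" by simp
qed

text \<open>It suffices to integrate over the one block with the same index as the cube.\<close>

lemma corner_cube_average_test_function:
  assumes p: "1 < p" and N: "N < m"
  shows "ennreal (1 / 4 ^ CARD('n))
    \<le> cube_average (half_open_cube (0 :: real^'n) (1 / 2 ^ N)) (\<lambda>y. ennreal (test_function p m y))"
proof -
  let ?Q = "half_open_cube (0 :: real^'n) (1 / 2 ^ N)"
  have m: "0 < mass p N" using p by (rule mass_pos)
  have "mass p N powr (- 1 / p) * mass p N powr (1 / p) = 1"
    using m by (simp add: powr_add[symmetric])
  then have "mass p N powr (- 1 / p) * block_volume TYPE('n) p N = 1 / (4 * 2 ^ N) ^ CARD('n)"
    by (simp add: block_volume_def)
  then have "ennreal (1 / (4 * 2 ^ N) ^ CARD('n))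
      = ennreal (mass p N powr (- 1 / p)) * emeasure lebesgue (block p N :: (real^'n) set)"
    unfolding emeasure_block[OF p] using block_volume_pos[OF p, of N, where 'n = 'n]
    by (subst ennreal_mult[symmetric]) auto
  also have "\<dots> = (\<integral>\<^sup>+y\<in>(block p N :: (real^'n) set). ennreal (mass p N powr (- 1 / p)) \<partial>lebesgue)"
    by (rule nn_integral_cmult_indicator[symmetric]) (rule block_sets)
  also have "\<dots> \<le> (\<integral>\<^sup>+y\<in>?Q. ennreal (test_function p m y) \<partial>lebesgue)"
  proof (rule nn_integral_mono)
    fix y :: "real^'n"
    show "ennreal (mass p N powr (- 1 / p)) * indicator (block p N) y
      \<le> ennreal (test_function p m y) * indicator ?Q y"
    proof (cases "y \<in> block p N")
      case True
      moreover have "y \<in> ?Q" using block_subset_corner_cube[OF p order_refl] True by blast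
      ultimately show ?thesis by (simp add: test_function_on_block[OF p True] N)
    qed simp
  qed
  finally have "ennreal (1 / (4 * 2 ^ N) ^ CARD('n)) / emeasure lebesgue ?Q
      \<le> cube_average ?Q (\<lambda>y. ennreal (test_function p m y))"
    unfolding cube_average_def by (rule divide_right_mono_ennreal)
  moreover have "ennreal (1 / (4 * 2 ^ N) ^ CARD('n)) / emeasure lebesgue ?Q = ennreal (1 / 4 ^ CARD('n))"
  proof -
    have "emeasure lebesgue ?Q = ennreal ((1 / 2 ^ N) ^ CARD('n))"
      by (rule emeasure_half_open_cube) simp
    moreover have "1 / (4 * 2 ^ N) ^ CARD('n) / (1 / 2 ^ N) ^ CARD('n) = (1 / 4 ^ CARD('n) :: real)"
      by (simp add: power_mult_distrib power_one_over)
    ultimately show ?thesis by (simp only: divide_ennreal zero_less_power zero_less_divide_1_iff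
        zero_le_divide_1_iff zero_le_power zero_less_numeral zero_le_numeral mult_nonneg_nonneg)
  qed
  ultimately show ?thesis by simp
qed

text \<open>A point of block \<open>j\<close> lies in all the cubes \<open>[0, 2\<^bsup>-N\<^esup>)\<^sup>n\<close> with \<open>N \<le> j\<close>. Those with \<open>N < m\<close> are \<open>m\<close> distinct
members of the family, each with an average bounded below.\<close>

lemma sparse_operator_test_function_ge:
  fixes x :: "real^'n"
  assumes p: "1 < p" and x: "x \<in> block p j" and mj: "m \<le> j"
  shows "ennreal (real m / 4 ^ CARD('n)) \<le> sparse_operator corner_family (test_function p m) x"
proof -
  let ?Q = "\<lambda>N. half_open_cube (0 :: real^'n) (1 / 2 ^ N)"
  let ?f = "\<lambda>Q. cube_average Q (\<lambda>y. ennreal (test_function p m y)) * indicator Q x"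
  have sub: "?Q ` {..<m} \<subseteq> corner_family"
  proof -
    have "range ?Q = corner_level 0" by (simp add: corner_level_def)
    then show ?thesis unfolding corner_family_def by blast
  qed
  have "ennreal (real m / 4 ^ CARD('n)) = (\<Sum>N<m. ennreal (1 / 4 ^ CARD('n)))"
    by (subst sum_ennreal) auto
  also have "\<dots> \<le> (\<Sum>N<m. ?f (?Q N))"
  proof (rule sum_mono)
    fix N assume "N \<in> {..<m}"
    then have N: "N < m" "N \<le> j" using mj by auto
    then have "x \<in> ?Q N" using block_subset_corner_cube[OF p N(2)] x by blast
    then show "ennreal (1 / 4 ^ CARD('n)) \<le> ?f (?Q N)"
      using corner_cube_average_test_function[OF p N(1), where 'n = 'n] by simp
  qed
  also have "\<dots> = sum ?f (?Q ` {..<m})"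
    by (subst sum.reindex) (auto intro: inj_on_subset[OF inj_corner_cube])
  also have "\<dots> = infsum ?f (?Q ` {..<m})" by simp
  also have "\<dots> \<le> infsum ?f corner_family"
    using sub by (intro infsum_mono_neutral nonneg_summable_on_complete) auto
  finally show ?thesis by (simp only: sparse_operator_def)
qed

text \<open>On every block from \<open>m\<close> on the sparse operator is at least \<open>m / 4\<^sup>n\<close>, and these blocks together have
mass \<open>tail_mass p m\<close>.\<close>

lemma sparse_operator_weighted_integral_ge:
  assumes p: "1 < p"
  shows "ennreal ((real m / 4 ^ CARD('n)) powr p * tail_mass p m)
    \<le> (\<integral>\<^sup>+x. ennreal_powr (sparse_operator corner_family (test_function p m) (x :: real^'n)) p
        * ennreal (block_weight p x) \<partial>lebesgue)"
proof -
  define a where "a = (real m / 4 ^ CARD('n)) powr p"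
  have a: "0 \<le> a" by (simp add: a_def)
  let ?U = "\<Union>j\<in>{m..}. block p j :: (real^'n) set"
  have U [measurable]: "?U \<in> sets lebesgue" by (intro sets.countable_UN'') auto
  define h where "h l = (if l < m then 0 else a * mass p l)" for l
  have "(\<lambda>j. h (j + m)) sums (a * tail_mass p m)"
    unfolding h_def using sums_mult[OF mass_sums_tail[OF p, of m], of a] by simp
  then have "h sums (a * tail_mass p m + (\<Sum>l<m. h l))" by (simp only: sums_iff_shift)
  then have "h sums (a * tail_mass p m)" by (simp add: h_def)
  moreover have "0 \<le> h l" for l
    using a mass_pos[OF p, of l] by (simp add: h_def)
  ultimately have "ennreal (a * tail_mass p m) = (\<Sum>l. ennreal (h l))"
    by (intro suminf_ennreal_eq[symmetric]) auto
  also have "\<dots> \<le> (\<Sum>l. ennreal (mass p l / block_volume TYPE('n) p l)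
      * (\<integral>\<^sup>+x\<in>block p l. ennreal a * indicator ?U x \<partial>lebesgue))"
  proof (intro suminf_le allI)
    fix l
    show "ennreal (h l) \<le> ennreal (mass p l / block_volume TYPE('n) p l)
      * (\<integral>\<^sup>+x\<in>block p l. ennreal a * indicator ?U x \<partial>lebesgue)"
    proof (cases "l < m")
      case False
      have "ennreal (h l) = ennreal a * ennreal (mass p l)"
        using False a mass_pos[OF p, of l] by (simp add: h_def ennreal_mult)
      also have "\<dots> = ennreal (mass p l / block_volume TYPE('n) p l)
          * (\<integral>\<^sup>+x\<in>(block p l :: (real^'n) set). ennreal a \<partial>lebesgue)"
        by (rule nn_integral_const_block[OF p, symmetric])
      also have "(\<integral>\<^sup>+x\<in>(block p l :: (real^'n) set). ennreal a \<partial>lebesgue)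
          = (\<integral>\<^sup>+x\<in>block p l. ennreal a * indicator ?U x \<partial>lebesgue)"
        using False by (intro nn_integral_cong) (auto split: split_indicator)
      finally show ?thesis by simp
    qed (simp add: h_def)
  qed auto
  also have "\<dots> = (\<integral>\<^sup>+x. (ennreal a * indicator ?U x) * ennreal (block_weight p x) \<partial>lebesgue)"
    by (rule nn_integral_block_weight[OF p, symmetric]) measurable
  also have "\<dots> \<le> (\<integral>\<^sup>+x. ennreal_powr (sparse_operator corner_family (test_function p m) (x :: real^'n)) p
        * ennreal (block_weight p x) \<partial>lebesgue)"
  proof (intro nn_integral_mono mult_right_mono)
    fix x :: "real^'n"
    show "ennreal a * indicator ?U x \<le> ennreal_powr (sparse_operator corner_family (test_function p m) x) p"
    proof (cases "x \<in> ?U")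
      case True
      then obtain j where j: "m \<le> j" "x \<in> block p j" by auto
      have "ennreal a = ennreal_powr (ennreal (real m / 4 ^ CARD('n))) p"
        by (simp add: a_def)
      also have "\<dots> \<le> ennreal_powr (sparse_operator corner_family (test_function p m) x) p"
        using p by (intro ennreal_powr_mono sparse_operator_test_function_ge[OF p j(2,1)]) auto
      finally show ?thesis using True by simp
    qed simp
  qed simp
  finally show ?thesis by (simp only: a_def)
qed

text \<open>With \<open>q = (p - 1) / 2\<close> the left-hand side grows at least like \<open>m\<^bsup>1+q\<^esup>\<close>.\<close>

lemma growth_contradiction:
  assumes p: "1 < p" and b: "0 < b"
    and le: "\<And>m. (real m / b) powr p * tail_mass p m \<le> c * real m"
  shows False
proof -
  define q where "q = (p - 1) / 2"
  have q: "0 < q" using p by (simp add: q_def)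
  define K where "K = c * b powr p * 2 powr q"
  have bound: "real m powr q \<le> K" if m: "0 < m" for m
  proof -
    have m': "0 < real m" using m by simp
    have tail_mass: "tail_mass p m = (real m + 1) powr - q"
      by (simp only: tail_mass_def q_def minus_divide_left)
    have "(2 * real m) powr - q \<le> tail_mass p m"
      unfolding tail_mass using m q by (intro powr_mono2') auto
    then have "(real m / b) powr p * (2 * real m) powr - q \<le> (real m / b) powr p * tail_mass p m"
      by (rule mult_left_mono) simp
    also have "\<dots> \<le> c * real m" by (rule le)
    finally have *: "(real m / b) powr p * (2 * real m) powr - q \<le> c * real m" .
    have split: "real m powr p = real m powr q * real m powr q * real m"
    proof -
      have "p = q + q + 1" by (simp add: q_def)
      then have "real m powr p = real m powr (q + q + 1)" by simp
      also have "\<dots> = real m powr q * real m powr q * real m" using m' by (simp only: powr_add powr_one)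
      finally show ?thesis .
    qed
    have "(real m / b) powr p * (2 * real m) powr - q = real m powr q * real m / (b powr p * 2 powr q)"
      using m' b by (simp add: powr_divide powr_mult powr_minus split field_simps)
    with * have "real m powr q * real m \<le> c * real m * (b powr p * 2 powr q)"
      using b by (simp add: divide_le_eq)
    then have "real m powr q * real m \<le> K * real m" by (simp add: K_def mult_ac)
    then show ?thesis using m' by (simp add: mult_le_cancel_right)
  qed
  obtain m :: nat where m: "max 1 (K powr (1 / q)) < real m" using reals_Archimedean2 by blast
  then have m0: "0 < m" by (cases m) auto
  have K: "0 < K" using bound[OF m0] m0 by (intro less_le_trans[OF _ bound[OF m0]]) simp
  have "K = (K powr (1 / q)) powr q" using K q by (simp add: powr_powr)
  also have "\<dots> < real m powr q" using m q by (intro powr_less_mono2) auto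
  also have "\<dots> \<le> K" by (rule bound[OF m0])
  finally show False by simp
qed

lemma sparse_operator_unbounded:
  assumes p: "1 < p"
  shows "\<not> bounded_on_weighted_Lp {f. \<forall>x. 0 \<le> f x} p (block_weight p :: real^'n \<Rightarrow> real)
    (sparse_operator corner_family)"
proof
  assume "bounded_on_weighted_Lp {f. \<forall>x. 0 \<le> f x} p (block_weight p :: real^'n \<Rightarrow> real)
    (sparse_operator corner_family)"
  then obtain C where C: "0 \<le> C" and bdd: "\<And>f :: real^'n \<Rightarrow> real. f \<in> weighted_Lp p (block_weight p) \<Longrightarrow> (\<forall>x. 0 \<le> f x) \<Longrightarrow>
      weighted_norm p (block_weight p) (sparse_operator corner_family f)
        \<le> ennreal C * weighted_norm p (block_weight p) (\<lambda>x. ennreal \<bar>f x\<bar>)"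
    unfolding bounded_on_weighted_Lp_def by blast
  have "(real m / 4 ^ CARD('n)) powr p * tail_mass p m \<le> C powr p * real m" for m
  proof -
    let ?T = "\<integral>\<^sup>+x. ennreal_powr (sparse_operator corner_family (test_function p m) (x :: real^'n)) p
        * ennreal (block_weight p x) \<partial>lebesgue"
    have "ennreal_powr ?T (1 / p) \<le> ennreal C * ennreal_powr (ennreal (real m)) (1 / p)"
      using bdd[OF test_function_in_weighted_Lp[OF p], of m]
      by (simp only: weighted_norm_def test_function_weighted_integral[OF p] test_function_nonneg simp_thms)
    also have "\<dots> = ennreal (C * real m powr (1 / p))"
      using C by (simp add: ennreal_mult)
    finally have "ennreal_powr (ennreal_powr ?T (1 / p)) p \<le> ennreal_powr (ennreal (C * real m powr (1 / p))) p"
      using p by (intro ennreal_powr_mono) auto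
    moreover have "(C * real m powr (1 / p)) powr p = C powr p * real m"
      using C p by (simp add: powr_mult powr_powr)
    moreover have "0 \<le> C * real m powr (1 / p)" using C by simp
    ultimately have "?T \<le> ennreal (C powr p * real m)"
      using p by (simp only: ennreal_powr_inverse_powr ennreal_powr_ennreal)
    with sparse_operator_weighted_integral_ge[OF p, of m, where 'n = 'n]
    have "ennreal ((real m / 4 ^ CARD('n)) powr p * tail_mass p m) \<le> ennreal (C powr p * real m)"
      by (rule order_trans)
    then show ?thesis by (subst (asm) ennreal_le_iff) auto
  qed
  then show False by (intro growth_contradiction[OF p, of "4 ^ CARD('n)" "C powr p"]) simp_all
qed

theorem theorem1p2:
  fixes p :: real
  assumes "1 < p"
  shows "\<exists>w :: real^'n::finite \<Rightarrow> real.
           weight w \<and>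
           bounded_on_weighted_Lp UNIV p w maximal_operator \<and>
           \<not> bounded_on_weighted_Lp {f. \<forall>x. 0 \<le> f x} p w (sparse_operator corner_family)"
  using weight_block_weight[OF assms] maximal_operator_bounded[OF assms]
    sparse_operator_unbounded[OF assms] by blast

end
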